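(* (In $\mathbf{ZF}$.) Let $\mathbf{X}_1$, $\mathbf{X}_2$ and $\mathbf{Y}$ be sequential spaces such that $\mathbf{X}_1$ is a locally sequentially compact space for which $\mathbf{PCAC}(\mathbf{X}_1,scl)$ holds. Suppose that $g:\mathbf{X}_2\to\mathbf{Y}$ is a quotient mapping. Then: (i) $\mathbf{X}_1\times\mathbf{X}_2$ is sequential; (ii) the mapping $f=\mathrm{id}_{X_1}\times g:\mathbf{X}_1\times\mathbf{X}_2\to\mathbf{X}_1\times\mathbf{Y}$ is quotient.
   Context: The base theory is $\mathbf{ZF}$. A subset $A$ of a topological space $\mathbf{X}$ is sequentially closed in $\mathbf{X}$ if all limits of convergent in $\mathbf{X}$ sequences of points of $A$ belong to $A$; $\mathbf{X}$ is sequential if all its sequentially closed subsets are closed. A set $A\subseteq X$ is sequentially compact in $\mathbf{X}$ if each sequence of points of $A$ has a subsequence convergent in $\mathbf{X}$ to a point of $A$. A space $\mathbf{X}$ is locally sequentially compact if $\mathbf{X}$ is a $T_0$-space and, for every open set $V$ in $\mathbf{X}$ and each $x\in V$, there is an open neighbourhood $U$ of $x$ such that $\mathrm{cl}_{\mathbf{X}}(U)$ is sequentially compact in $\mathbf{X}$ and $\mathrm{cl}_{\mathbf{X}}(U)\subseteq V$. A partial choice function of a family $\{A_j:j\in J\}$ of non-empty sets is a choice function of $\{A_j:j\in J^{\star}\}$ for some infinite $J^{\star}\subseteq J$. $\mathbf{PCAC}(\mathbf{X},scl)$: every infinite countable family of non-empty sequentially closed subsets of $\mathbf{X}$ has a partial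 choice function. A mapping $f:\mathbf{X}\to\mathbf{Y}$ is quotient if it is a surjection such that, for every $W\subseteq Y$, $f^{-1}(W)$ is open in $\mathbf{X}$ if and only if $W$ is open in $\mathbf{Y}$. The mapping $\mathrm{id}_{X_1}\times g$ is given by $\langle x,z\rangle\mapsto\langle x,g(z)\rangle$. *)

theory Defs
  imports Main
begin

text \<open>
  The theorem is a theorem of ZF without the axiom of choice. HOL proves choice for its own sets
  (and hence PCAC for every space of HOL-Analysis), so the topology is not developed on HOL types
  but inside an arbitrary model \<open>(V, E)\<close> of first-order ZF: \<open>V\<close> is the type \<open>'v\<close> and
  \<open>E x y\<close> is the membership relation of the model. A sentence is provable in ZF iff it holds
  in all these models. Sets, functions, natural numbers and sequences below are elements of \<open>V\<close>
  (the natural numbers of the model may be nonstandard), every quantifier ranges over \<open>V\<close>, and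
  every notion is first-order definable from \<open>E\<close>.
\<close>

section \<open>Models of first-order ZF\<close>

text \<open>The schemas range over formulas only: ranging over HOL predicates instead would give
  second-order ZF, whose models inherit choice from HOL.\<close>

datatype fm = Mem nat nat | Eq nat nat | Neg fm | Conj fm fm | All nat fm

primrec sat :: "('v \<Rightarrow> 'v \<Rightarrow> bool) \<Rightarrow> fm \<Rightarrow> (nat \<Rightarrow> 'v) \<Rightarrow> bool" where
  "sat E (Mem i j) \<rho> \<longleftrightarrow> E (\<rho> i) (\<rho> j)"
| "sat E (Eq i j) \<rho> \<longleftrightarrow> \<rho> i = \<rho> j"
| "sat E (Neg \<phi>) \<rho> \<longleftrightarrow> \<not> sat E \<phi> \<rho>"
| "sat E (Conj \<phi> \<psi>) \<rho> \<longleftrightarrow> sat E \<phi> \<rho> \<and> sat E \<psi> \<rho>"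
| "sat E (All i \<phi>) \<rho> \<longleftrightarrow> (\<forall>x. sat E \<phi> (\<rho>(i := x)))"

context
  fixes E :: "'v \<Rightarrow> 'v \<Rightarrow> bool"  (infix "\<epsilon>" 50)
begin

definition subset_of :: "'v \<Rightarrow> 'v \<Rightarrow> bool"  (infix "\<sqsubseteq>" 50) where
  "a \<sqsubseteq> b \<longleftrightarrow> (\<forall>x. x \<epsilon> a \<longrightarrow> x \<epsilon> b)"

definition nonempty :: "'v \<Rightarrow> bool" where
  "nonempty a \<longleftrightarrow> (\<exists>x. x \<epsilon> a)"

definition is_inductive :: "'v \<Rightarrow> bool" where
  "is_inductive w \<longleftrightarrow>
     (\<exists>e. \<not> nonempty e \<and> e \<epsilon> w) \<and>
     (\<forall>n. n \<epsilon> w \<longrightarrow> (\<exists>s. (\<forall>z. z \<epsilon> s \<longleftrightarrow> z \<epsilon> n \<or> z = n) \<and> s \<epsilon> w))"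

definition extensionality_ax :: bool where
  "extensionality_ax \<longleftrightarrow> (\<forall>a b. (\<forall>x. x \<epsilon> a \<longleftrightarrow> x \<epsilon> b) \<longrightarrow> a = b)"

definition foundation_ax :: bool where
  "foundation_ax \<longleftrightarrow> (\<forall>a. nonempty a \<longrightarrow> (\<exists>x. x \<epsilon> a \<and> \<not> (\<exists>z. z \<epsilon> x \<and> z \<epsilon> a)))"

definition pairing_ax :: bool where
  "pairing_ax \<longleftrightarrow> (\<forall>a b. \<exists>c. \<forall>x. x \<epsilon> c \<longleftrightarrow> x = a \<or> x = b)"

definition union_ax :: bool where
  "union_ax \<longleftrightarrow> (\<forall>a. \<exists>u. \<forall>x. x \<epsilon> u \<longleftrightarrow> (\<exists>b. x \<epsilon> b \<and> b \<epsilon> a))"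

definition power_set_ax :: bool where
  "power_set_ax \<longleftrightarrow> (\<forall>a. \<exists>p. \<forall>x. x \<epsilon> p \<longleftrightarrow> x \<sqsubseteq> a)"

definition infinity_ax :: bool where
  "infinity_ax \<longleftrightarrow> (\<exists>w. is_inductive w)"

text \<open>In the two schemas the variables other than 0 (and 1) are parameters, with values given
  by \<open>\<rho>\<close>.\<close>

definition separation_schema :: bool where
  "separation_schema \<longleftrightarrow>
     (\<forall>\<phi> \<rho> a. \<exists>b. \<forall>x. x \<epsilon> b \<longleftrightarrow> x \<epsilon> a \<and> sat E \<phi> (\<rho>(0 := x)))"

definition replacement_schema :: bool where
  "replacement_schema \<longleftrightarrow>
     (\<forall>\<phi> \<rho> a.
        (\<forall>x y y'. x \<epsilon> a \<and> sat E \<phi> (\<rho>(0 := x, 1 := y)) \<and> sat E \<phi> (\<rho>(0 := x, 1 := y'))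
           \<longrightarrow> y = y') \<longrightarrow>
        (\<exists>b. \<forall>y. y \<epsilon> b \<longleftrightarrow> (\<exists>x. x \<epsilon> a \<and> sat E \<phi> (\<rho>(0 := x, 1 := y)))))"

definition ZF_model :: bool where
  "ZF_model \<longleftrightarrow> extensionality_ax \<and> foundation_ax \<and> pairing_ax \<and> union_ax \<and>
     power_set_ax \<and> infinity_ax \<and> separation_schema \<and> replacement_schema"

section \<open>Set theory in the model\<close>

text \<open>\<open>Coll P\<close> is the element of \<open>V\<close> whose members are exactly the \<open>x\<close> with \<open>P x\<close>. It is
  used only for conditions that define a set in ZF; otherwise its value is unspecified.\<close>

definition Coll :: "('v \<Rightarrow> bool) \<Rightarrow> 'v" where
  "Coll P = (THE a. \<forall>x. x \<epsilon> a \<longleftrightarrow> P x)"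

definition opair :: "'v \<Rightarrow> 'v \<Rightarrow> 'v" where
  "opair x y = Coll (\<lambda>z. z = Coll (\<lambda>u. u = x) \<or> z = Coll (\<lambda>u. u = x \<or> u = y))"

definition cprod :: "'v \<Rightarrow> 'v \<Rightarrow> 'v" where
  "cprod a b = Coll (\<lambda>p. \<exists>x y. x \<epsilon> a \<and> y \<epsilon> b \<and> p = opair x y)"

definition is_fun :: "'v \<Rightarrow> 'v \<Rightarrow> 'v \<Rightarrow> bool" where
  "is_fun f a b \<longleftrightarrow> f \<sqsubseteq> cprod a b \<and> (\<forall>x. x \<epsilon> a \<longrightarrow> (\<exists>!y. opair x y \<epsilon> f))"

definition app :: "'v \<Rightarrow> 'v \<Rightarrow> 'v" where
  "app f x = (THE y. opair x y \<epsilon> f)"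

definition injection :: "'v \<Rightarrow> 'v \<Rightarrow> 'v \<Rightarrow> bool" where
  "injection f a b \<longleftrightarrow> is_fun f a b \<and>
     (\<forall>x x'. x \<epsilon> a \<and> x' \<epsilon> a \<and> app f x = app f x' \<longrightarrow> x = x')"

definition surjection :: "'v \<Rightarrow> 'v \<Rightarrow> 'v \<Rightarrow> bool" where
  "surjection f a b \<longleftrightarrow> is_fun f a b \<and> (\<forall>y. y \<epsilon> b \<longrightarrow> (\<exists>x. x \<epsilon> a \<and> app f x = y))"

definition omega :: 'v where
  "omega = Coll (\<lambda>n. \<forall>w. is_inductive w \<longrightarrow> n \<epsilon> w)"

text \<open>Natural numbers are von Neumann ordinals: \<open>n\<close> is the set of its predecessors, and
  \<open>m < n\<close> is \<open>m \<epsilon> n\<close>.\<close>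

definition finite_set :: "'v \<Rightarrow> bool" where
  "finite_set a \<longleftrightarrow> (\<exists>n f. n \<epsilon> omega \<and> injection f n a \<and> surjection f n a)"

definition countable_set :: "'v \<Rightarrow> bool" where
  "countable_set a \<longleftrightarrow> (\<exists>f. injection f a omega)"

section \<open>Topological spaces in the model\<close>

text \<open>A space is given by its set of points \<open>X\<close> and its set of open sets \<open>T\<close>.\<close>

definition topological_space :: "'v \<Rightarrow> 'v \<Rightarrow> bool" where
  "topological_space X T \<longleftrightarrow>
     (\<forall>U. U \<epsilon> T \<longrightarrow> U \<sqsubseteq> X) \<and>
     Coll (\<lambda>x. False) \<epsilon> T \<and> X \<epsilon> T \<and>
     (\<forall>U V. U \<epsilon> T \<and> V \<epsilon> T \<longrightarrow> Coll (\<lambda>x. x \<epsilon> U \<and> x \<epsilon> V) \<epsilon> T) \<and>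
     (\<forall>F. F \<sqsubseteq> T \<longrightarrow> Coll (\<lambda>x. \<exists>U. U \<epsilon> F \<and> x \<epsilon> U) \<epsilon> T)"

definition T0 :: "'v \<Rightarrow> 'v \<Rightarrow> bool" where
  "T0 X T \<longleftrightarrow> (\<forall>x y. x \<epsilon> X \<and> y \<epsilon> X \<and> x \<noteq> y \<longrightarrow> (\<exists>U. U \<epsilon> T \<and> (x \<epsilon> U \<longleftrightarrow> \<not> y \<epsilon> U)))"

definition closed_set :: "'v \<Rightarrow> 'v \<Rightarrow> 'v \<Rightarrow> bool" where
  "closed_set X T A \<longleftrightarrow> A \<sqsubseteq> X \<and> Coll (\<lambda>x. x \<epsilon> X \<and> \<not> x \<epsilon> A) \<epsilon> T"

definition cl :: "'v \<Rightarrow> 'v \<Rightarrow> 'v \<Rightarrow> 'v" where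
  "cl X T A = Coll (\<lambda>x. x \<epsilon> X \<and> (\<forall>C. closed_set X T C \<and> A \<sqsubseteq> C \<longrightarrow> x \<epsilon> C))"

definition converges :: "'v \<Rightarrow> 'v \<Rightarrow> 'v \<Rightarrow> 'v \<Rightarrow> bool" where
  "converges X T s x \<longleftrightarrow> is_fun s omega X \<and> x \<epsilon> X \<and>
     (\<forall>U. U \<epsilon> T \<and> x \<epsilon> U \<longrightarrow>
        (\<exists>m. m \<epsilon> omega \<and> (\<forall>n. n \<epsilon> omega \<and> (m \<epsilon> n \<or> m = n) \<longrightarrow> app s n \<epsilon> U)))"

definition subsequence :: "'v \<Rightarrow> 'v \<Rightarrow> bool" where
  "subsequence t s \<longleftrightarrow>
     (\<exists>k. is_fun k omega omega \<and>
        (\<forall>m n. m \<epsilon> omega \<and> n \<epsilon> omega \<and> m \<epsilon> n \<longrightarrow> app k m \<epsilon> app k n) \<and>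
        (\<forall>n. n \<epsilon> omega \<longrightarrow> app t n = app s (app k n)))"

definition sequentially_closed :: "'v \<Rightarrow> 'v \<Rightarrow> 'v \<Rightarrow> bool" where
  "sequentially_closed X T A \<longleftrightarrow> A \<sqsubseteq> X \<and>
     (\<forall>s x. is_fun s omega A \<and> converges X T s x \<longrightarrow> x \<epsilon> A)"

definition sequential_space :: "'v \<Rightarrow> 'v \<Rightarrow> bool" where
  "sequential_space X T \<longleftrightarrow> topological_space X T \<and>
     (\<forall>A. sequentially_closed X T A \<longrightarrow> closed_set X T A)"

definition sequentially_compact :: "'v \<Rightarrow> 'v \<Rightarrow> 'v \<Rightarrow> bool" where
  "sequentially_compact X T A \<longleftrightarrow> A \<sqsubseteq> X \<and>
     (\<forall>s. is_fun s omega A \<longrightarrow>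
        (\<exists>t x. is_fun t omega A \<and> subsequence t s \<and> x \<epsilon> A \<and> converges X T t x))"

definition locally_sequentially_compact :: "'v \<Rightarrow> 'v \<Rightarrow> bool" where
  "locally_sequentially_compact X T \<longleftrightarrow> topological_space X T \<and> T0 X T \<and>
     (\<forall>V x. V \<epsilon> T \<and> x \<epsilon> V \<longrightarrow>
        (\<exists>U. U \<epsilon> T \<and> x \<epsilon> U \<and> sequentially_compact X T (cl X T U) \<and> cl X T U \<sqsubseteq> V))"

text \<open>A family \<open>{A\<^sub>j : j \<in> J}\<close> is a function \<open>A\<close> on its index set \<open>J\<close>. A partial choice
  function of a family of subsets of \<open>X\<close> is a function on an infinite part of \<open>J\<close>; its values
  automatically lie in \<open>X\<close>.\<close>

definition PCAC_scl :: "'v \<Rightarrow> 'v \<Rightarrow> bool" where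
  "PCAC_scl X T \<longleftrightarrow>
     (\<forall>J F A. countable_set J \<and> \<not> finite_set J \<and> is_fun A J F \<and>
        (\<forall>j. j \<epsilon> J \<longrightarrow> nonempty (app A j) \<and> sequentially_closed X T (app A j)) \<longrightarrow>
        (\<exists>J' c. J' \<sqsubseteq> J \<and> \<not> finite_set J' \<and> is_fun c J' X \<and>
           (\<forall>j. j \<epsilon> J' \<longrightarrow> app c j \<epsilon> app A j)))"

definition prod_topology :: "'v \<Rightarrow> 'v \<Rightarrow> 'v" where
  "prod_topology T S = Coll (\<lambda>W. \<forall>p. p \<epsilon> W \<longrightarrow>
     (\<exists>U V. U \<epsilon> T \<and> V \<epsilon> S \<and> p \<epsilon> cprod U V \<and> cprod U V \<sqsubseteq> W))"

definition preimage :: "'v \<Rightarrow> 'v \<Rightarrow> 'v \<Rightarrow> 'v" where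
  "preimage f X W = Coll (\<lambda>x. x \<epsilon> X \<and> app f x \<epsilon> W)"

definition quotient_mapping :: "'v \<Rightarrow> 'v \<Rightarrow> 'v \<Rightarrow> 'v \<Rightarrow> 'v \<Rightarrow> bool" where
  "quotient_mapping X T Y S f \<longleftrightarrow> surjection f X Y \<and>
     (\<forall>W. W \<sqsubseteq> Y \<longrightarrow> (preimage f X W \<epsilon> T \<longleftrightarrow> W \<epsilon> S))"

definition id_times :: "'v \<Rightarrow> 'v \<Rightarrow> 'v \<Rightarrow> 'v" where
  "id_times X Z g = Coll (\<lambda>q. \<exists>x z. x \<epsilon> X \<and> z \<epsilon> Z \<and> q = opair (opair x z) (opair x (app g z)))"

end

end

theory Submission
  imports Defs
begin

text \<open>
  Let \<open>A\<close> be sequentially closed in \<open>X\<^sub>1 \<times> X\<^sub>2\<close>, and let \<open>K \<subseteq> X\<^sub>1\<close> be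
  sequentially closed and sequentially compact. Then the projection
  \<open>{y. \<exists>x \<in> K. \<langle>x, y\<rangle> \<in> A}\<close> is sequentially closed in \<open>X\<^sub>2\<close>
  (\<open>projection_sequentially_closed\<close>): for a convergent sequence \<open>s\<close> in it, the slices
  \<open>{x \<in> K. \<langle>x, s\<^sub>n\<rangle> \<in> A}\<close> are non-empty and sequentially closed, so PCAC selects points from
  infinitely many of them, and sequential compactness makes the selected points converge along a
  subsequence. As \<open>X\<^sub>2\<close> is sequential, the set of all \<open>y\<close> with \<open>K \<times> {y}\<close> disjoint from \<open>A\<close>
  is open.

  Given \<open>\<langle>x, y\<rangle> \<notin> A\<close>, take for \<open>K\<close> the closure of a neighbourhood \<open>U\<close> of \<open>x\<close> such that
  \<open>K \<times> {y}\<close> is disjoint from \<open>A\<close>. Then \<open>\<langle>x, y\<rangle>\<close> has the open box \<open>U \<times> {y'. K \<times> {y'} \<inter> A = {}}\<close>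
  outside \<open>A\<close> (\<open>tube_neighbourhood\<close>). This proves that the product is sequential. For the quotient
  mapping, the second side of this box is saturated with respect to \<open>g\<close> when \<open>A\<close> is the
  complement of a preimage under \<open>id \<times> g\<close>, so its image is open in \<open>Y\<close>
  (\<open>id_times_quotient\<close>).

  All of this takes place in a model of first-order ZF, where every set must come from a formula.
  Definability is handled by closure rules on HOL predicates (\<open>definable_intros\<close>), with
  separation as their consumer; new sequences are cut out of products in this way.
  Recursion on the natural numbers of the model is avoided. In particular
  the infinite index set \<open>J\<close> that comes with partial choice is never enumerated: the map sending
  \<open>n\<close> to the least element of \<open>J\<close> above \<open>n\<close> serves instead
  (\<open>partial_choice_sequence\<close>).
\<close>

section \<open>Definability over a model\<close>

primrec rename_fm :: "(nat \<Rightarrow> nat) \<Rightarrow> fm \<Rightarrow> fm" where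
  "rename_fm f (Mem i j) = Mem (f i) (f j)"
| "rename_fm f (Eq i j) = Eq (f i) (f j)"
| "rename_fm f (Neg \<phi>) = Neg (rename_fm f \<phi>)"
| "rename_fm f (Conj \<phi> \<psi>) = Conj (rename_fm f \<phi>) (rename_fm f \<psi>)"
| "rename_fm f (All i \<phi>) = All (f i) (rename_fm f \<phi>)"

lemma sat_rename_fm:
  assumes "inj f"
  shows "sat E (rename_fm f \<phi>) \<rho> \<longleftrightarrow> sat E \<phi> (\<rho> \<circ> f)"
proof (induction \<phi> arbitrary: \<rho>)
  case (All i \<phi>)
  have "(\<rho>(f i := x)) \<circ> f = (\<rho> \<circ> f)(i := x)" for x
    using assms by (auto simp: fun_eq_iff inj_eq)
  then show ?case by (simp only: rename_fm.simps sat.simps All.IH)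
qed auto

text \<open>An environment that carries two streams of values: the even variables hold the arguments of a
  predicate, the odd ones its parameters. Both streams are infinite, so an injective renaming makes
  room for further parameters or for a bound variable without any count of the variables that
  occur in a formula.\<close>

definition interleave :: "(nat \<Rightarrow> 'v) \<Rightarrow> (nat \<Rightarrow> 'v) \<Rightarrow> nat \<Rightarrow> 'v" where
  "interleave \<rho> \<sigma> n = (if even n then \<rho> (n div 2) else \<sigma> (n div 2))"

locale zf_universe =
  fixes E :: "'v \<Rightarrow> 'v \<Rightarrow> bool"  (infix "\<epsilon>" 50)
  assumes ZF: "ZF_model E"
begin

abbreviation sub  (infix "\<sqsubseteq>" 50) where "a \<sqsubseteq> b \<equiv> subset_of E a b"
abbreviation pair  ("\<langle>_,/ _\<rangle>") where "\<langle>x, y\<rangle> \<equiv> opair E x y"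

text \<open>The separation schema speaks about formulas, but writing formulas down is avoided: a predicate on
  environments is definable if some formula with parameters \<open>\<sigma>\<close> expresses it, and definability is
  then derived by closure rules that follow the syntax of the HOL predicate. In an environment
  \<open>\<rho>\<close> the value \<open>\<rho> 0\<close> belongs to the innermost bound variable, as with de Bruijn indices.\<close>

definition definable :: "((nat \<Rightarrow> 'v) \<Rightarrow> bool) \<Rightarrow> bool" where
  "definable P \<longleftrightarrow> (\<exists>\<phi> \<sigma>. \<forall>\<rho>. P \<rho> \<longleftrightarrow> sat E \<phi> (interleave \<rho> \<sigma>))"

text \<open>The terms of the language of sets are variables and parameters only. Compound terms are not
  admitted: \<open>app f x\<close> in particular is a description, and a description without a unique
  witness has no value that a formula could determine. Definable predicates below therefore say
  \<open>\<langle>x, y\<rangle> \<epsilon> f\<close> instead of \<open>y = app f x\<close>.\<close>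

definition atom :: "((nat \<Rightarrow> 'v) \<Rightarrow> 'v) \<Rightarrow> bool" where
  "atom t \<longleftrightarrow> (\<exists>i. t = (\<lambda>\<rho>. \<rho> i)) \<or> (\<exists>c. t = (\<lambda>\<rho>. c))"

named_theorems dfn

lemma atom_var [dfn]: "atom (\<lambda>\<rho>. \<rho> i)"
  and atom_const [dfn]: "atom (\<lambda>\<rho>. c)"
  by (auto simp: atom_def)

lemma definable_atomic:
  assumes "atom t" "atom u"
  shows definable_mem: "definable (\<lambda>\<rho>. t \<rho> \<epsilon> u \<rho>)"
    and definable_eq: "definable (\<lambda>\<rho>. t \<rho> = u \<rho>)"
proof -
  have "\<exists>i j \<sigma>. \<forall>\<rho>. t \<rho> = interleave \<rho> \<sigma> i \<and> u \<rho> = interleave \<rho> \<sigma> j"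
    using assms unfolding atom_def
  proof (elim disjE exE)
    fix i j assume "t = (\<lambda>\<rho>. \<rho> i)" "u = (\<lambda>\<rho>. \<rho> j)"
    then show ?thesis by (intro exI[of _ "2*i"] exI[of _ "2*j"]) (simp add: interleave_def)
  next
    fix i d assume "t = (\<lambda>\<rho>. \<rho> i)" "u = (\<lambda>\<rho>. d)"
    then show ?thesis
      by (intro exI[of _ "2*i"] exI[of _ 1] exI[of _ "\<lambda>_. d"]) (simp add: interleave_def)
  next
    fix c j assume "t = (\<lambda>\<rho>. c)" "u = (\<lambda>\<rho>. \<rho> j)"
    then show ?thesis
      by (intro exI[of _ 1] exI[of _ "2*j"] exI[of _ "\<lambda>_. c"]) (simp add: interleave_def)
  next
    fix c d assume "t = (\<lambda>\<rho>. c)" "u = (\<lambda>\<rho>. d)"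
    then show ?thesis
      by (intro exI[of _ 1] exI[of _ 3] exI[of _ "\<lambda>n. if n = 0 then c else d"])
        (simp add: interleave_def)
  qed
  then obtain i j \<sigma> where "\<forall>\<rho>. t \<rho> = interleave \<rho> \<sigma> i \<and> u \<rho> = interleave \<rho> \<sigma> j"
    by blast
  then have "\<forall>\<rho>. t \<rho> \<epsilon> u \<rho> \<longleftrightarrow> sat E (Mem i j) (interleave \<rho> \<sigma>)"
    "\<forall>\<rho>. t \<rho> = u \<rho> \<longleftrightarrow> sat E (Eq i j) (interleave \<rho> \<sigma>)" by auto
  then show "definable (\<lambda>\<rho>. t \<rho> \<epsilon> u \<rho>)" "definable (\<lambda>\<rho>. t \<rho> = u \<rho>)"
    unfolding definable_def by blast+
qed

lemma definable_not [dfn]: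
  assumes "definable P" shows "definable (\<lambda>\<rho>. \<not> P \<rho>)"
proof -
  obtain \<phi> \<sigma> where "\<forall>\<rho>. P \<rho> \<longleftrightarrow> sat E \<phi> (interleave \<rho> \<sigma>)"
    using assms unfolding definable_def by blast
  then have "\<forall>\<rho>. \<not> P \<rho> \<longleftrightarrow> sat E (Neg \<phi>) (interleave \<rho> \<sigma>)" by simp
  then show ?thesis unfolding definable_def by blast
qed

text \<open>The parameters of the two formulas are merged into one stream, where those of the first formula
  take the even places and those of the second the odd ones; \<open>f\<close> and \<open>g\<close> are the corresponding
  renamings of the variables.\<close>

lemma definable_conj [dfn]:
  assumes "definable P" "definable Q"
  shows "definable (\<lambda>\<rho>. P \<rho> \<and> Q \<rho>)"
proof -
  obtain \<phi> \<sigma> \<psi> \<tau> where P: "\<forall>\<rho>. P \<rho> \<longleftrightarrow> sat E \<phi> (interleave \<rho> \<sigma>)"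
    and Q: "\<forall>\<rho>. Q \<rho> \<longleftrightarrow> sat E \<psi> (interleave \<rho> \<tau>)"
    using assms unfolding definable_def by blast
  define f :: "nat \<Rightarrow> nat" where "f n = (if even n then n else 2 * n - 1)" for n
  define g :: "nat \<Rightarrow> nat" where "g n = (if even n then n else 2 * n + 1)" for n
  have odd_sub: "odd n \<Longrightarrow> odd (2 * n - 1)" for n :: nat by (cases n) auto
  have f: "inj f" unfolding inj_def f_def
    using odd_sub by (auto split: if_splits)
  have g: "inj g" by (auto simp: inj_def g_def split: if_splits)
  define \<upsilon> where "\<upsilon> = interleave \<sigma> \<tau>"
  have fg: "f (2 * k) = 2 * k" "g (2 * k) = 2 * k"
    "f (2 * k + 1) = 2 * (2 * k) + 1" "g (2 * k + 1) = 2 * (2 * k + 1) + 1" for k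
    by (simp_all add: f_def g_def)
  have "interleave \<rho> \<upsilon> (f n) = interleave \<rho> \<sigma> n" "interleave \<rho> \<upsilon> (g n) = interleave \<rho> \<tau> n" for \<rho> n
    by (cases "even n"; (elim evenE oddE)?; simp only: fg; simp add: interleave_def \<upsilon>_def)+
  then have "interleave \<rho> \<upsilon> \<circ> f = interleave \<rho> \<sigma>" "interleave \<rho> \<upsilon> \<circ> g = interleave \<rho> \<tau>" for \<rho>
    by (auto simp: fun_eq_iff)
  then have "\<forall>\<rho>. P \<rho> \<and> Q \<rho> \<longleftrightarrow>
      sat E (Conj (rename_fm f \<phi>) (rename_fm g \<psi>)) (interleave \<rho> \<upsilon>)"
    by (simp add: P Q sat_rename_fm f g)
  then show ?thesis unfolding definable_def by blast
qed

text \<open>The quantified variable has number 0 in the premise, whereas the conclusion has all even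
  variables for its own arguments. Variable 0 is renamed to 1, which becomes free by moving all
  parameters up by one place, and the arguments move down by one place.\<close>

lemma definable_all [dfn]:
  assumes "definable (\<lambda>\<rho>. P (\<lambda>n. \<rho> (Suc n)) (\<rho> 0))"
  shows "definable (\<lambda>\<rho>. \<forall>x. P \<rho> x)"
proof -
  obtain \<phi> \<sigma> where P: "\<And>\<rho>. P (\<lambda>n. \<rho> (Suc n)) (\<rho> 0) \<longleftrightarrow> sat E \<phi> (interleave \<rho> \<sigma>)"
    using assms unfolding definable_def by blast
  define f :: "nat \<Rightarrow> nat"
    where "f n = (if n = 0 then 1 else if even n then n - 2 else n + 2)" for n
  have f: "inj f"
    by (rule inj_on_inverseI[of _ "\<lambda>n. if n = 1 then 0 else if even n then n + 2 else n - 2"])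
      (auto simp: f_def; presburger)
  define \<tau> where "\<tau> n = \<sigma> (n - 1)" for n
  have env: "(interleave \<rho> \<tau>)(1 := x) \<circ> f = interleave (case_nat x \<rho>) \<sigma>" for \<rho> x
    by (auto simp: fun_eq_iff interleave_def f_def \<tau>_def elim!: oddE evenE split: nat.split)
  have "(\<forall>x. P \<rho> x) \<longleftrightarrow> sat E (All 1 (rename_fm f \<phi>)) (interleave \<rho> \<tau>)" for \<rho>
    using P[of "case_nat x \<rho>" for x] by (simp add: sat_rename_fm[OF f] env del: One_nat_def)
  then show ?thesis unfolding definable_def by blast
qed

lemma definable_disj [dfn]:
  assumes "definable P" "definable Q" shows "definable (\<lambda>\<rho>. P \<rho> \<or> Q \<rho>)"
proof -
  have "definable (\<lambda>\<rho>. \<not> (\<not> P \<rho> \<and> \<not> Q \<rho>))" by (intro dfn assms)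
  then show ?thesis by simp
qed

lemma definable_imp [dfn]:
  assumes "definable P" "definable Q" shows "definable (\<lambda>\<rho>. P \<rho> \<longrightarrow> Q \<rho>)"
  unfolding imp_conv_disj by (intro dfn assms)

lemma definable_iff [dfn]:
  assumes "definable P" "definable Q" shows "definable (\<lambda>\<rho>. P \<rho> \<longleftrightarrow> Q \<rho>)"
  unfolding iff_conv_conj_imp by (intro dfn assms)

lemma definable_ex [dfn]:
  assumes "definable (\<lambda>\<rho>. P (\<lambda>n. \<rho> (Suc n)) (\<rho> 0))"
  shows "definable (\<lambda>\<rho>. \<exists>x. P \<rho> x)"
proof -
  have "definable (\<lambda>\<rho>. \<not> (\<forall>x. \<not> P \<rho> x))" by (intro dfn assms)
  then show ?thesis by simp
qed

lemma definable_sub [dfn]: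
  assumes "atom t" "atom u" shows "definable (\<lambda>\<rho>. t \<rho> \<sqsubseteq> u \<rho>)"
  using assms unfolding subset_of_def atom_def
  by (elim disjE exE; hypsubst; intro dfn definable_mem)

section \<open>Sets\<close>

definition is_set :: "('v \<Rightarrow> bool) \<Rightarrow> bool" where
  "is_set P \<longleftrightarrow> (\<exists>a. \<forall>x. x \<epsilon> a \<longleftrightarrow> P x)"

lemma set_eqI: "(\<And>x. x \<epsilon> a \<longleftrightarrow> x \<epsilon> b) \<Longrightarrow> a = b"
  using ZF unfolding ZF_model_def extensionality_ax_def by blast

lemma set_eq_iff: "a = b \<longleftrightarrow> (\<forall>x. x \<epsilon> a \<longleftrightarrow> x \<epsilon> b)"
  by (blast intro: set_eqI)

lemma mem_Coll:
  assumes "is_set P" shows "x \<epsilon> Coll E P \<longleftrightarrow> P x"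
proof -
  obtain a where a: "\<forall>x. x \<epsilon> a \<longleftrightarrow> P x" using assms unfolding is_set_def by blast
  have "Coll E P = a" unfolding Coll_def using a by (blast intro: set_eqI)
  then show ?thesis using a by simp
qed

lemma separation:
  assumes "definable (\<lambda>\<rho>. P (\<rho> 0))" "\<And>x. P x \<Longrightarrow> x \<epsilon> a"
  shows "is_set P"
proof -
  obtain \<phi> \<sigma> where \<phi>: "\<And>\<rho>. P (\<rho> 0) \<longleftrightarrow> sat E \<phi> (interleave \<rho> \<sigma>)"
    using assms(1) unfolding definable_def by blast
  obtain b where b: "\<And>x. x \<epsilon> b \<longleftrightarrow> x \<epsilon> a \<and> sat E \<phi> ((interleave \<sigma> \<sigma>)(0 := x))"
    using ZF unfolding ZF_model_def separation_schema_def by meson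
  have "(interleave \<sigma> \<sigma>)(0 := x) = interleave (\<sigma>(0 := x)) \<sigma>" for x
    by (auto simp: fun_eq_iff interleave_def elim!: evenE)
  then have "x \<epsilon> b \<longleftrightarrow> P x" for x
    using b \<phi>[of "\<sigma>(0 := x)"] assms(2) by auto
  then show ?thesis unfolding is_set_def by blast
qed

lemma sub_iff: "a \<sqsubseteq> b \<longleftrightarrow> (\<forall>x. x \<epsilon> a \<longrightarrow> x \<epsilon> b)"
  by (simp add: subset_of_def)

lemma subD: "a \<sqsubseteq> b \<Longrightarrow> x \<epsilon> a \<Longrightarrow> x \<epsilon> b"
  by (simp add: subset_of_def)

lemma power_exists: "\<exists>p. \<forall>x. x \<epsilon> p \<longleftrightarrow> x \<sqsubseteq> a"
  using ZF unfolding ZF_model_def power_set_ax_def by blast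

lemma is_set_upair: "is_set (\<lambda>x. x = a \<or> x = b)"
  using ZF unfolding ZF_model_def pairing_ax_def is_set_def by blast

lemma is_set_singleton: "is_set (\<lambda>x. x = a)"
  using is_set_upair[of a a] by simp

lemma is_set_union: "is_set (\<lambda>x. x \<epsilon> a \<or> x \<epsilon> b)"
proof -
  obtain c where c: "\<forall>x. x \<epsilon> c \<longleftrightarrow> x = a \<or> x = b"
    using is_set_upair unfolding is_set_def by blast
  obtain u where "\<forall>x. x \<epsilon> u \<longleftrightarrow> (\<exists>b. x \<epsilon> b \<and> b \<epsilon> c)"
    using ZF unfolding ZF_model_def union_ax_def by blast
  then have "\<forall>x. x \<epsilon> u \<longleftrightarrow> x \<epsilon> a \<or> x \<epsilon> b" using c by auto
  then show ?thesis unfolding is_set_def by (rule exI)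
qed

lemma is_set_empty: "is_set (\<lambda>x. False)"
proof (rule separation)
  have "definable (\<lambda>\<rho>. \<rho> 0 \<noteq> \<rho> 0)" by (intro dfn definable_eq)
  then show "definable (\<lambda>\<rho>. False)" by simp
  show "x \<epsilon> undefined" if False for x using that by simp
qed

lemmas mem_sets [simp] = is_set_singleton[THEN mem_Coll] is_set_upair[THEN mem_Coll]
  is_set_empty[THEN mem_Coll]

lemma opair_inject [simp]: "\<langle>x, y\<rangle> = \<langle>x', y'\<rangle> \<longleftrightarrow> x = x' \<and> y = y'"
proof
  let ?s = "\<lambda>x. Coll E (\<lambda>u. u = x)" and ?d = "\<lambda>x y. Coll E (\<lambda>u. u = x \<or> u = y)"
  assume eq: "\<langle>x, y\<rangle> = \<langle>x', y'\<rangle>"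
  have 1: "z = ?s x \<or> z = ?d x y \<longleftrightarrow> z = ?s x' \<or> z = ?d x' y'" for z
    using arg_cong[OF eq, of "\<lambda>p. z \<epsilon> p"] unfolding opair_def by simp
  have ss: "?s a = ?s b \<longleftrightarrow> a = b" for a b
    unfolding set_eq_iff[of "?s a"] by auto
  have sd: "?s a = ?d b c \<longleftrightarrow> a = b \<and> a = c" "?d b c = ?s a \<longleftrightarrow> a = b \<and> a = c" for a b c
    unfolding set_eq_iff[of "?s a"] set_eq_iff[of "?d b c"] by auto
  have dd: "?d a b = ?d a c \<longleftrightarrow> b = c" for a b c
    unfolding set_eq_iff[of "?d a b"] by simp metis
  have x: "x = x'" using 1[of "?s x"] by (auto simp: ss sd)
  have "y = x \<or> y = y'" using 1[of "?d x y"] by (auto simp: x sd dd)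
  moreover have "y' = x \<or> y' = y" using 1[of "?d x' y'"] by (auto simp: x sd dd)
  ultimately show "x = x' \<and> y = y'" using x by auto
qed simp

lemma eq_opair_iff:
  "p = \<langle>x, y\<rangle> \<longleftrightarrow>
     (\<forall>z. z \<epsilon> p \<longleftrightarrow> (\<forall>u. u \<epsilon> z \<longleftrightarrow> u = x) \<or> (\<forall>u. u \<epsilon> z \<longleftrightarrow> u = x \<or> u = y))"
proof -
  have "z \<epsilon> \<langle>x, y\<rangle> \<longleftrightarrow> z = Coll E (\<lambda>u. u = x) \<or> z = Coll E (\<lambda>u. u = x \<or> u = y)" for z
    unfolding opair_def by simp
  also have "\<dots> z \<longleftrightarrow> (\<forall>u. u \<epsilon> z \<longleftrightarrow> u = x) \<or> (\<forall>u. u \<epsilon> z \<longleftrightarrow> u = x \<or> u = y)" for z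
    by (simp add: set_eq_iff[of z])
  finally show ?thesis by (simp add: set_eq_iff[of p])
qed

lemma definable_eq_opair:
  assumes "atom p" "atom x" "atom y"
  shows "definable (\<lambda>\<rho>. p \<rho> = \<langle>x \<rho>, y \<rho>\<rangle>)"
  using assms unfolding eq_opair_iff atom_def
  by (elim disjE exE; hypsubst; intro dfn definable_mem definable_eq)

lemma definable_opair_mem:
  assumes "atom x" "atom y" "atom a"
  shows "definable (\<lambda>\<rho>. \<langle>x \<rho>, y \<rho>\<rangle> \<epsilon> a \<rho>)"
proof -
  have "definable (\<lambda>\<rho>. \<exists>p. p = \<langle>x \<rho>, y \<rho>\<rangle> \<and> p \<epsilon> a \<rho>)"
    using assms unfolding atom_def
    by (elim disjE exE; hypsubst; intro dfn definable_eq_opair definable_mem)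
  then show ?thesis by simp
qed

text \<open>The order matters: the rules for pairs come before the rules for bare membership and equality,
  which match the same goals but would leave a pair where an atom is needed.\<close>

lemmas definable_intros =
  definable_eq_opair definable_opair_mem definable_mem definable_eq dfn

lemma mem_cprod: "p \<epsilon> cprod E a b \<longleftrightarrow> (\<exists>x y. x \<epsilon> a \<and> y \<epsilon> b \<and> p = \<langle>x, y\<rangle>)"
  unfolding cprod_def
proof (rule mem_Coll)
  obtain c where c: "\<And>x. x \<epsilon> c \<longleftrightarrow> x \<epsilon> a \<or> x \<epsilon> b"
    using is_set_union unfolding is_set_def by metis
  obtain d where d: "\<And>x. x \<epsilon> d \<longleftrightarrow> x \<sqsubseteq> c" using power_exists by meson
  obtain e where e: "\<And>x. x \<epsilon> e \<longleftrightarrow> x \<sqsubseteq> d" using power_exists by meson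
  show "is_set (\<lambda>p. \<exists>x y. x \<epsilon> a \<and> y \<epsilon> b \<and> p = \<langle>x, y\<rangle>)"
  proof (rule separation)
    show "definable (\<lambda>\<rho>. \<exists>x y. x \<epsilon> a \<and> y \<epsilon> b \<and> \<rho> 0 = \<langle>x, y\<rangle>)"
      by (intro definable_intros)
    show "p \<epsilon> e" if "\<exists>x y. x \<epsilon> a \<and> y \<epsilon> b \<and> p = \<langle>x, y\<rangle>" for p
      using that by (auto simp: e d c sub_iff opair_def)
  qed
qed

lemma opair_mem_cprod [simp]: "\<langle>x, y\<rangle> \<epsilon> cprod E a b \<longleftrightarrow> x \<epsilon> a \<and> y \<epsilon> b"
  by (auto simp: mem_cprod)

section \<open>Functions\<close>

lemma app_mem:
  assumes "is_fun E f a b" "x \<epsilon> a" shows "\<langle>x, app E f x\<rangle> \<epsilon> f"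
  unfolding app_def by (rule theI') (use assms in \<open>simp add: is_fun_def\<close>)

lemma fun_opairD:
  assumes "is_fun E f a b" "\<langle>x, y\<rangle> \<epsilon> f" shows "x \<epsilon> a" "y \<epsilon> b"
proof -
  have "\<langle>x, y\<rangle> \<epsilon> cprod E a b" using assms subD unfolding is_fun_def by blast
  then show "x \<epsilon> a" "y \<epsilon> b" by simp_all
qed

lemma opair_mem_fun:
  assumes "is_fun E f a b" shows "\<langle>x, y\<rangle> \<epsilon> f \<longleftrightarrow> x \<epsilon> a \<and> y = app E f x"
proof
  assume xy: "\<langle>x, y\<rangle> \<epsilon> f"
  then have x: "x \<epsilon> a" by (rule fun_opairD[OF assms])
  then have "\<exists>!y. \<langle>x, y\<rangle> \<epsilon> f" using assms unfolding is_fun_def by simp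
  then show "x \<epsilon> a \<and> y = app E f x" using x xy app_mem[OF assms x] by auto
qed (use app_mem[OF assms] in simp)

lemma app_type:
  assumes "is_fun E f a b" "x \<epsilon> a" shows "app E f x \<epsilon> b"
  using app_mem[OF assms] by (rule fun_opairD[OF assms(1)])

lemma fun_codomain:
  assumes f: "is_fun E f a b" and c: "\<And>x. x \<epsilon> a \<Longrightarrow> app E f x \<epsilon> c"
  shows "is_fun E f a c"
proof -
  have "p \<epsilon> cprod E a c" if "p \<epsilon> f" for p
  proof -
    have "p \<epsilon> cprod E a b" using f that subD unfolding is_fun_def by blast
    then obtain x y where p: "p = \<langle>x, y\<rangle>" unfolding mem_cprod by blast
    then show ?thesis using that c by (simp add: opair_mem_fun[OF f])
  qed
  then show ?thesis using f unfolding is_fun_def sub_iff by blast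
qed

text \<open>Since the codomain is given in advance, separation inside the product yields the graph.
  Composites, pairings and the sequences of the main argument are built this way.\<close>

lemma fun_exists:
  assumes "definable (\<lambda>\<rho>. R (\<rho> (Suc 0)) (\<rho> 0))"
    and "\<And>x. x \<epsilon> a \<Longrightarrow> \<exists>!y. y \<epsilon> b \<and> R x y"
  shows "\<exists>f. is_fun E f a b \<and> (\<forall>x. x \<epsilon> a \<longrightarrow> R x (app E f x))"
proof -
  have "is_set (\<lambda>p. \<exists>x y. x \<epsilon> a \<and> y \<epsilon> b \<and> p = \<langle>x, y\<rangle> \<and> R x y)"
  proof (rule separation)
    show "definable (\<lambda>\<rho>. \<exists>x y. x \<epsilon> a \<and> y \<epsilon> b \<and> \<rho> 0 = \<langle>x, y\<rangle> \<and> R x y)"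
      by (intro definable_intros assms(1))
    show "p \<epsilon> cprod E a b" if "\<exists>x y. x \<epsilon> a \<and> y \<epsilon> b \<and> p = \<langle>x, y\<rangle> \<and> R x y" for p
      using that by auto
  qed
  then obtain f where f: "\<And>p. p \<epsilon> f \<longleftrightarrow> (\<exists>x y. x \<epsilon> a \<and> y \<epsilon> b \<and> p = \<langle>x, y\<rangle> \<and> R x y)"
    unfolding is_set_def by blast
  have opair_f: "\<langle>x, y\<rangle> \<epsilon> f \<longleftrightarrow> x \<epsilon> a \<and> y \<epsilon> b \<and> R x y" for x y
    by (simp add: f)
  have "f \<sqsubseteq> cprod E a b" by (auto simp: sub_iff f)
  then have is_f: "is_fun E f a b" unfolding is_fun_def opair_f using assms(2) by simp
  then have "R x (app E f x)" if "x \<epsilon> a" for x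
    using app_mem[OF is_f that] unfolding opair_f by simp
  then show ?thesis using is_f by blast
qed

lemma compose_exists:
  assumes f: "is_fun E f a b" and g: "is_fun E g b c"
  shows "\<exists>h. is_fun E h a c \<and> (\<forall>x. x \<epsilon> a \<longrightarrow> app E h x = app E g (app E f x))"
proof -
  have "\<exists>h. is_fun E h a c \<and> (\<forall>x. x \<epsilon> a \<longrightarrow> (\<exists>y. \<langle>x, y\<rangle> \<epsilon> f \<and> \<langle>y, app E h x\<rangle> \<epsilon> g))"
    by (rule fun_exists, intro definable_intros)
      (use app_type[OF g] app_type[OF f] in \<open>auto simp: opair_mem_fun[OF f] opair_mem_fun[OF g]\<close>)
  then show ?thesis using opair_mem_fun[OF f] opair_mem_fun[OF g] by metis
qed

lemma pair_fun_exists: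
  assumes f: "is_fun E f a b" and g: "is_fun E g a c"
  shows "\<exists>h. is_fun E h a (cprod E b c) \<and>
           (\<forall>x. x \<epsilon> a \<longrightarrow> app E h x = \<langle>app E f x, app E g x\<rangle>)"
proof -
  have "\<exists>h. is_fun E h a (cprod E b c) \<and>
      (\<forall>x. x \<epsilon> a \<longrightarrow> (\<exists>y z. \<langle>x, y\<rangle> \<epsilon> f \<and> \<langle>x, z\<rangle> \<epsilon> g \<and> app E h x = \<langle>y, z\<rangle>))"
    by (rule fun_exists, intro definable_intros)
      (use app_type[OF g] app_type[OF f] in \<open>auto simp: opair_mem_fun[OF f] opair_mem_fun[OF g]\<close>)
  then show ?thesis using opair_mem_fun[OF f] opair_mem_fun[OF g] by metis
qed

lemma const_fun_exists:
  assumes "y \<epsilon> b"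
  shows "\<exists>f. is_fun E f a b \<and> (\<forall>x. x \<epsilon> a \<longrightarrow> app E f x = y)"
  by (rule fun_exists, intro definable_intros) (use assms in auto)

section \<open>Natural numbers\<close>

abbreviation zero where "zero \<equiv> Coll E (\<lambda>x. False)"
abbreviation succ where "succ n \<equiv> Coll E (\<lambda>z. z \<epsilon> n \<or> z = n)"
abbreviation le  (infix "\<preceq>" 50) where "m \<preceq> n \<equiv> m \<epsilon> n \<or> m = n"

lemma mem_succ [simp]: "z \<epsilon> succ n \<longleftrightarrow> z \<epsilon> n \<or> z = n"
  using mem_Coll[OF is_set_union[of n "Coll E (\<lambda>x. x = n)"]] by simp

lemma is_inductive_iff:
  "is_inductive E w \<longleftrightarrow> zero \<epsilon> w \<and> (\<forall>n. n \<epsilon> w \<longrightarrow> succ n \<epsilon> w)"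
proof -
  have "\<not> nonempty E e \<longleftrightarrow> e = zero" for e
    unfolding nonempty_def by (simp add: set_eq_iff)
  moreover have "(\<forall>z. z \<epsilon> s \<longleftrightarrow> z \<epsilon> n \<or> z = n) \<longleftrightarrow> s = succ n" for s n
    by (simp add: set_eq_iff[of s])
  ultimately show ?thesis unfolding is_inductive_def by simp
qed

lemma mem_omega: "n \<epsilon> omega E \<longleftrightarrow> (\<forall>w. is_inductive E w \<longrightarrow> n \<epsilon> w)"
  unfolding omega_def
proof (rule mem_Coll)
  obtain w where w: "is_inductive E w"
    using ZF unfolding ZF_model_def infinity_ax_def by blast
  show "is_set (\<lambda>n. \<forall>w. is_inductive E w \<longrightarrow> n \<epsilon> w)"
  proof (rule separation)
    show "definable (\<lambda>\<rho>. \<forall>w. is_inductive E w \<longrightarrow> \<rho> 0 \<epsilon> w)"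
      unfolding is_inductive_def nonempty_def by (intro definable_intros)
  qed (use w in blast)
qed

lemma zero_omega: "zero \<epsilon> omega E"
  and succ_omega: "n \<epsilon> omega E \<Longrightarrow> succ n \<epsilon> omega E"
  unfolding mem_omega is_inductive_iff by blast+

lemma omega_induct [consumes 2, case_names zero succ]:
  assumes "definable (\<lambda>\<rho>. P (\<rho> 0))" "n \<epsilon> omega E"
    and "P zero" "\<And>n. n \<epsilon> omega E \<Longrightarrow> P n \<Longrightarrow> P (succ n)"
  shows "P n"
proof -
  have "is_set (\<lambda>n. n \<epsilon> omega E \<and> P n)"
    by (rule separation[where a = "omega E"]) (intro definable_intros assms(1), simp)
  then obtain b where b: "\<And>n. n \<epsilon> b \<longleftrightarrow> n \<epsilon> omega E \<and> P n" unfolding is_set_def by blast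
  have "is_inductive E b"
    unfolding is_inductive_iff b using assms(3,4) zero_omega succ_omega by blast
  then show ?thesis using assms(2) b mem_omega by blast
qed

lemma not_mem_self: "\<not> x \<epsilon> x"
proof -
  have "nonempty E (Coll E (\<lambda>u. u = x))" by (auto simp: nonempty_def)
  then show ?thesis using ZF unfolding ZF_model_def foundation_ax_def by fastforce
qed

lemma omega_transitive:
  assumes "n \<epsilon> omega E" "k \<epsilon> n" shows "k \<epsilon> omega E" and "k \<sqsubseteq> n"
proof -
  have "definable (\<lambda>\<rho>. \<forall>k. k \<epsilon> \<rho> 0 \<longrightarrow> k \<epsilon> omega E \<and> k \<sqsubseteq> \<rho> 0)"
    by (intro definable_intros)
  then have "\<forall>k. k \<epsilon> n \<longrightarrow> k \<epsilon> omega E \<and> k \<sqsubseteq> n" using assms(1)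
    by (induction rule: omega_induct) (auto simp: sub_iff)
  then show "k \<epsilon> omega E" "k \<sqsubseteq> n" using assms(2) by auto
qed

lemma le_trans: "n \<epsilon> omega E \<Longrightarrow> k \<preceq> m \<Longrightarrow> m \<preceq> n \<Longrightarrow> k \<preceq> n"
  using omega_transitive(2) subD by blast

lemma succ_le:
  assumes "n \<epsilon> omega E" "m \<epsilon> n" shows "succ m \<preceq> n"
proof -
  have "definable (\<lambda>\<rho>. \<forall>m s. m \<epsilon> \<rho> 0 \<and> (\<forall>z. z \<epsilon> s \<longleftrightarrow> z \<epsilon> m \<or> z = m) \<longrightarrow> s \<preceq> \<rho> 0)"
    by (intro definable_intros)
  then have all: "\<forall>m s. m \<epsilon> n \<and> (\<forall>z. z \<epsilon> s \<longleftrightarrow> z \<epsilon> m \<or> z = m) \<longrightarrow> s \<preceq> n" using assms(1)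
  proof (induction rule: omega_induct)
    case (succ n)
    have "s = succ n" if "\<forall>z. z \<epsilon> s \<longleftrightarrow> z \<epsilon> n \<or> z = n" for s
      using that by (simp add: set_eq_iff[of s])
    then show ?case using succ.IH by auto
  qed simp
  show ?thesis using all[rule_format, of m "succ m"] assms(2) by simp
qed

lemma le_antisym: "j \<epsilon> omega E \<Longrightarrow> m \<preceq> j \<Longrightarrow> j \<preceq> m \<Longrightarrow> j = m"
  using omega_transitive(2)[of j m] subD[of m j j] not_mem_self[of j] by iprover

lemma zero_le: "n \<epsilon> omega E \<Longrightarrow> zero \<preceq> n"
proof -
  assume n: "n \<epsilon> omega E"
  have "definable (\<lambda>\<rho>. zero \<preceq> \<rho> 0)" by (intro definable_intros)
  then show ?thesis using n by (induction rule: omega_induct) auto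
qed

lemma omega_linear:
  assumes "m \<epsilon> omega E" "n \<epsilon> omega E" shows "m \<epsilon> n \<or> n \<preceq> m"
proof -
  have "definable (\<lambda>\<rho>. \<rho> 0 \<epsilon> n \<or> n \<preceq> \<rho> 0)" by (intro definable_intros)
  then show ?thesis using assms(1)
  proof (induction rule: omega_induct)
    case zero then show ?case using zero_le[OF assms(2)] by auto
  next
    case (succ m) then show ?case using succ_le[OF assms(2)] by auto
  qed
qed

lemma omega_max:
  assumes "m \<epsilon> omega E" "n \<epsilon> omega E"
  shows "\<exists>k. k \<epsilon> omega E \<and> m \<preceq> k \<and> n \<preceq> k"
  using omega_linear[OF assms] assms by blast

text \<open>Foundation gives an \<open>\<epsilon>\<close>-minimal element, and minimal elements are least because the order is
  linear.\<close>

lemma omega_least: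
  assumes "definable (\<lambda>\<rho>. P (\<rho> 0))" "\<And>i. P i \<Longrightarrow> i \<epsilon> omega E" "P i"
  shows "\<exists>m. P m \<and> (\<forall>i. P i \<longrightarrow> m \<preceq> i)"
proof -
  obtain b where b: "\<And>i. i \<epsilon> b \<longleftrightarrow> P i"
    using separation[OF assms(1,2)] unfolding is_set_def by blast
  then have "nonempty E b" using assms(3) unfolding nonempty_def by blast
  then have "\<exists>m. m \<epsilon> b \<and> \<not> (\<exists>z. z \<epsilon> m \<and> z \<epsilon> b)"
    using ZF unfolding ZF_model_def foundation_ax_def by simp
  then obtain m where m: "P m" "\<And>i. P i \<Longrightarrow> \<not> i \<epsilon> m" unfolding b by blast
  have "m \<preceq> i" if "P i" for i
    using omega_linear[OF assms(2)[OF m(1)] assms(2)[OF that]] m(2)[OF that] by auto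
  then show ?thesis using m(1) by blast
qed

lemma increasing_ge:
  assumes k: "is_fun E k (omega E) (omega E)"
    and inc: "\<And>m n. m \<epsilon> omega E \<Longrightarrow> n \<epsilon> omega E \<Longrightarrow> m \<epsilon> n \<Longrightarrow> app E k m \<epsilon> app E k n"
    and n: "n \<epsilon> omega E"
  shows "n \<preceq> app E k n"
proof -
  have k_iff: "(\<exists>v. \<langle>n, v\<rangle> \<epsilon> k \<and> n \<preceq> v) \<longleftrightarrow> n \<preceq> app E k n" if "n \<epsilon> omega E" for n
    using that by (simp add: opair_mem_fun[OF k])
  have "definable (\<lambda>\<rho>. \<exists>v. \<langle>\<rho> 0, v\<rangle> \<epsilon> k \<and> \<rho> 0 \<preceq> v)" by (intro definable_intros)
  then have "\<exists>v. \<langle>n, v\<rangle> \<epsilon> k \<and> n \<preceq> v" using n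
  proof (induction rule: omega_induct)
    case zero
    show ?case unfolding k_iff[OF zero_omega] using zero_le[OF app_type[OF k zero_omega]] .
  next
    case (succ n)
    have s: "succ n \<epsilon> omega E" using succ_omega succ by blast
    have w: "app E k (succ n) \<epsilon> omega E" using app_type[OF k s] .
    have "n \<preceq> app E k n" using succ k_iff by blast
    moreover have "app E k n \<epsilon> app E k (succ n)" using inc[OF succ.hyps s] by simp
    ultimately have "n \<epsilon> app E k (succ n)" using omega_transitive(2)[OF w] subD by metis
    then show ?case unfolding k_iff[OF s] using succ_le[OF w] by blast
  qed
  then show ?thesis using k_iff[OF n] by blast
qed

text \<open>A bijection from \<open>m\<close> onto \<open>b\<close>, stated through the pairs in \<open>f\<close> so that it is visibly
  definable.\<close>

definition enumerates :: "'v \<Rightarrow> 'v \<Rightarrow> 'v \<Rightarrow> bool" where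
  "enumerates f m b \<longleftrightarrow>
     (\<forall>p. p \<epsilon> f \<longrightarrow> (\<exists>i y. i \<epsilon> m \<and> y \<epsilon> b \<and> p = \<langle>i, y\<rangle>)) \<and>
     (\<forall>i. i \<epsilon> m \<longrightarrow> (\<exists>y. \<langle>i, y\<rangle> \<epsilon> f)) \<and> (\<forall>y. y \<epsilon> b \<longrightarrow> (\<exists>i. \<langle>i, y\<rangle> \<epsilon> f)) \<and>
     (\<forall>i y y'. \<langle>i, y\<rangle> \<epsilon> f \<and> \<langle>i, y'\<rangle> \<epsilon> f \<longrightarrow> y = y') \<and>
     (\<forall>i i' y. \<langle>i, y\<rangle> \<epsilon> f \<and> \<langle>i', y\<rangle> \<epsilon> f \<longrightarrow> i = i')"

lemma enumeratesD:
  assumes "enumerates f m b"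
  shows "p \<epsilon> f \<Longrightarrow> \<exists>i y. i \<epsilon> m \<and> y \<epsilon> b \<and> p = \<langle>i, y\<rangle>"
    and "i \<epsilon> m \<Longrightarrow> \<exists>y. \<langle>i, y\<rangle> \<epsilon> f"
    and "y \<epsilon> b \<Longrightarrow> \<exists>i. \<langle>i, y\<rangle> \<epsilon> f"
    and "\<langle>i, y\<rangle> \<epsilon> f \<Longrightarrow> \<langle>i, y'\<rangle> \<epsilon> f \<Longrightarrow> y = y'"
    and "\<langle>i, y\<rangle> \<epsilon> f \<Longrightarrow> \<langle>i', y\<rangle> \<epsilon> f \<Longrightarrow> i = i'"
proof -
  note en = assms[unfolded enumerates_def]
  show "p \<epsilon> f \<Longrightarrow> \<exists>i y. i \<epsilon> m \<and> y \<epsilon> b \<and> p = \<langle>i, y\<rangle>"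
    by (rule en[THEN conjunct1, rule_format])
  show "i \<epsilon> m \<Longrightarrow> \<exists>y. \<langle>i, y\<rangle> \<epsilon> f"
    by (rule en[THEN conjunct2, THEN conjunct1, rule_format])
  note en = en[THEN conjunct2, THEN conjunct2]
  show "y \<epsilon> b \<Longrightarrow> \<exists>i. \<langle>i, y\<rangle> \<epsilon> f"
    by (rule en[THEN conjunct1, rule_format])
  note en = en[THEN conjunct2]
  show "\<langle>i, y\<rangle> \<epsilon> f \<Longrightarrow> \<langle>i, y'\<rangle> \<epsilon> f \<Longrightarrow> y = y'"
    by (rule en[THEN conjunct1, rule_format]) (rule conjI)
  show "\<langle>i, y\<rangle> \<epsilon> f \<Longrightarrow> \<langle>i', y\<rangle> \<epsilon> f \<Longrightarrow> i = i'"
    by (rule en[THEN conjunct2, rule_format]) (rule conjI)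
qed

lemma enumerates_finite:
  assumes "enumerates f m b" "m \<epsilon> omega E" shows "finite_set E b"
proof -
  note en = enumeratesD[OF assms(1)]
  have "f \<sqsubseteq> cprod E m b" unfolding sub_iff mem_cprod using en(1) by iprover
  moreover have "\<exists>!y. \<langle>i, y\<rangle> \<epsilon> f" if "i \<epsilon> m" for i
    using en(2)[OF that] en(4) by (rule ex_ex1I)
  ultimately have f: "is_fun E f m b" unfolding is_fun_def by simp
  have "i = i'" if "i \<epsilon> m" "i' \<epsilon> m" "app E f i = app E f i'" for i i'
    using app_mem[OF f that(1)] app_mem[OF f that(2)] en(5) unfolding that(3) by iprover
  then have "injection E f m b" unfolding injection_def using f by simp
  moreover have "\<exists>i. i \<epsilon> m \<and> app E f i = y" if "y \<epsilon> b" for y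
    using en(3)[OF that] by (auto simp: opair_mem_fun[OF f])
  then have "surjection E f m b" unfolding surjection_def using f by simp
  ultimately show ?thesis using assms(2) unfolding finite_set_def by blast
qed

lemma enumerates_insert:
  assumes "enumerates f m b" and y: "\<not> y \<epsilon> b"
    and b': "\<And>z. z \<epsilon> b' \<longleftrightarrow> z \<epsilon> b \<or> z = y"
  shows "\<exists>f'. enumerates f' (succ m) b'"
proof -
  note en = enumeratesD[OF assms(1)]
  obtain f' where f': "\<And>p. p \<epsilon> f' \<longleftrightarrow> p \<epsilon> f \<or> p = \<langle>m, y\<rangle>"
    using is_set_union[of f "Coll E (\<lambda>p. p = \<langle>m, y\<rangle>)"] unfolding is_set_def by auto
  have dom: "i \<epsilon> m \<and> z \<epsilon> b" if "\<langle>i, z\<rangle> \<epsilon> f" for i z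
    using en(1)[OF that] by auto
  have new: "\<not> \<langle>m, z\<rangle> \<epsilon> f" "\<not> \<langle>i, y\<rangle> \<epsilon> f" for i z
    using dom not_mem_self[of m] y by iprover+
  have opair_f': "\<langle>i, z\<rangle> \<epsilon> f' \<longleftrightarrow> \<langle>i, z\<rangle> \<epsilon> f \<or> i = m \<and> z = y" for i z
    by (simp add: f')
  have "enumerates f' (succ m) b'"
    unfolding enumerates_def
  proof (intro conjI allI impI)
    show "\<exists>i z. i \<epsilon> succ m \<and> z \<epsilon> b' \<and> p = \<langle>i, z\<rangle>" if "p \<epsilon> f'" for p
      using that en(1)[of p] unfolding f' b' mem_succ by iprover
    show "\<exists>z. \<langle>i, z\<rangle> \<epsilon> f'" if "i \<epsilon> succ m" for i
      using that en(2)[of i] unfolding opair_f' mem_succ by iprover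
    show "\<exists>i. \<langle>i, z\<rangle> \<epsilon> f'" if "z \<epsilon> b'" for z
      using that en(3)[of z] unfolding opair_f' b' by iprover
    show "z = z'" if "\<langle>i, z\<rangle> \<epsilon> f' \<and> \<langle>i, z'\<rangle> \<epsilon> f'" for i z z'
      using that en(4)[of i z z'] new unfolding opair_f' by auto
    show "i = i'" if "\<langle>i, z\<rangle> \<epsilon> f' \<and> \<langle>i', z\<rangle> \<epsilon> f'" for i i' z
      using that en(5)[of i z i'] new unfolding opair_f' by auto
  qed
  then show ?thesis by blast
qed

text \<open>Induction on the bound: a subset of \<open>n + 1\<close> either avoids \<open>n\<close> or arises from a subset of
  \<open>n\<close> by adding one element. In the contrapositive, infinite sets of natural numbers are
  unbounded.\<close>

lemma bounded_finite:
  assumes "n \<epsilon> omega E" "b \<sqsubseteq> n" shows "finite_set E b"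
proof -
  have "definable (\<lambda>\<rho>. \<forall>b. b \<sqsubseteq> \<rho> 0 \<longrightarrow> (\<exists>f m. m \<epsilon> omega E \<and> enumerates f m b))"
    unfolding enumerates_def by (intro definable_intros)
  then have "\<forall>b. b \<sqsubseteq> n \<longrightarrow> (\<exists>f m. m \<epsilon> omega E \<and> enumerates f m b)" using assms(1)
  proof (induction rule: omega_induct)
    case zero
    have "enumerates zero zero b" if "b \<sqsubseteq> zero" for b
      using that by (simp add: enumerates_def sub_iff)
    then show ?case using zero_omega by blast
  next
    case (succ n)
    show ?case
    proof (intro allI impI)
      fix b assume b: "b \<sqsubseteq> succ n"
      have "is_set (\<lambda>z. z \<epsilon> b \<and> z \<noteq> n)"
        by (rule separation[where a = b]) (intro definable_intros, simp)
      then obtain b' where b': "\<And>z. z \<epsilon> b' \<longleftrightarrow> z \<epsilon> b \<and> z \<noteq> n" unfolding is_set_def by blast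
      have "b' \<sqsubseteq> n" using b unfolding sub_iff b' mem_succ by iprover
      then obtain f m where fm: "m \<epsilon> omega E" "enumerates f m b'" using succ by blast
      show "\<exists>f m. m \<epsilon> omega E \<and> enumerates f m b"
      proof (cases "n \<epsilon> b")
        case True
        have "\<exists>f'. enumerates f' (succ m) b"
          by (rule enumerates_insert[OF fm(2), of n]) (use b' True in auto)
        then show ?thesis using succ_omega fm(1) by blast
      next
        case False
        then have "b' = b" unfolding set_eq_iff[of b'] b' by metis
        then show ?thesis using fm by blast
      qed
    qed
  qed
  then show ?thesis using assms(2) enumerates_finite by blast
qed

text \<open>The values of a function on a natural number are bounded, by induction on its domain, so such a
  function misses the bound.\<close>

lemma omega_infinite: "\<not> finite_set E (omega E)"
proof
  assume "finite_set E (omega E)"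
  then obtain n f where n: "n \<epsilon> omega E" and f: "is_fun E f n (omega E)"
    and surj: "\<And>y. y \<epsilon> omega E \<Longrightarrow> \<exists>x. x \<epsilon> n \<and> app E f x = y"
    unfolding finite_set_def surjection_def by blast
  have "definable (\<lambda>\<rho>. \<exists>m. m \<epsilon> omega E \<and> (\<forall>i v. i \<epsilon> \<rho> 0 \<and> \<langle>i, v\<rangle> \<epsilon> f \<longrightarrow> v \<epsilon> m))"
    by (intro definable_intros)
  then have "\<exists>m. m \<epsilon> omega E \<and> (\<forall>i v. i \<epsilon> n \<and> \<langle>i, v\<rangle> \<epsilon> f \<longrightarrow> v \<epsilon> m)" using n
  proof (induction rule: omega_induct)
    case zero then show ?case using zero_omega by auto
  next
    case (succ k)
    then obtain m where m: "m \<epsilon> omega E" "\<And>i v. i \<epsilon> k \<Longrightarrow> \<langle>i, v\<rangle> \<epsilon> f \<Longrightarrow> v \<epsilon> m" by blast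
    show ?case
    proof (cases "k \<epsilon> n")
      case True
      then have "succ (app E f k) \<epsilon> omega E" using succ_omega app_type[OF f] by blast
      then obtain m' where m': "m' \<epsilon> omega E" "m \<preceq> m'" "succ (app E f k) \<preceq> m'"
        using omega_max[OF m(1)] by blast
      have "app E f k \<epsilon> m'"
        using le_trans m'(1,3) omega_transitive(2)[OF m'(1)] subD mem_succ by metis
      moreover have "v \<epsilon> m'" if "v \<epsilon> m" for v
        using that m'(2) omega_transitive(2)[OF m'(1)] subD by blast
      ultimately have "v \<epsilon> m'" if "i \<epsilon> succ k" "\<langle>i, v\<rangle> \<epsilon> f" for i v
        using that m(2)[of i v] by (auto simp: opair_mem_fun[OF f])
      then show ?thesis using m'(1) by blast
    next
      case False
      then have "v \<epsilon> m" if "i \<epsilon> succ k" "\<langle>i, v\<rangle> \<epsilon> f" for i v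
        using that m(2)[of i v] by (auto simp: opair_mem_fun[OF f])
      then show ?thesis using m(1) by blast
    qed
  qed
  then obtain m where m: "m \<epsilon> omega E" "\<And>i v. i \<epsilon> n \<Longrightarrow> \<langle>i, v\<rangle> \<epsilon> f \<Longrightarrow> v \<epsilon> m" by blast
  obtain i where "i \<epsilon> n" "app E f i = m" using surj[OF m(1)] by blast
  then have "m \<epsilon> m" using m(2) app_mem[OF f] by blast
  then show False using not_mem_self by blast
qed

lemma omega_countable: "countable_set E (omega E)"
proof -
  have "\<exists>f. is_fun E f (omega E) (omega E) \<and> (\<forall>x. x \<epsilon> omega E \<longrightarrow> app E f x = x)"
    by (rule fun_exists, intro definable_intros) blast
  then obtain f where f: "is_fun E f (omega E) (omega E)"
    "\<And>x. x \<epsilon> omega E \<Longrightarrow> app E f x = x" by blast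
  then have "injection E f (omega E) (omega E)" unfolding injection_def by auto
  then show ?thesis unfolding countable_set_def by blast
qed

section \<open>Convergence and sequentially closed sets\<close>

abbreviation compl where "compl X A \<equiv> Coll E (\<lambda>x. x \<epsilon> X \<and> \<not> x \<epsilon> A)"

lemma mem_compl [simp]: "x \<epsilon> compl X A \<longleftrightarrow> x \<epsilon> X \<and> \<not> x \<epsilon> A"
  by (rule mem_Coll, rule separation[where a = X]) (intro definable_intros, simp)

lemma mem_inter [simp]: "x \<epsilon> Coll E (\<lambda>x. x \<epsilon> U \<and> x \<epsilon> V) \<longleftrightarrow> x \<epsilon> U \<and> x \<epsilon> V"
  by (rule mem_Coll, rule separation[where a = U]) (intro definable_intros, simp)

lemma mem_Union [simp]: "x \<epsilon> Coll E (\<lambda>x. \<exists>U. U \<epsilon> F \<and> x \<epsilon> U) \<longleftrightarrow> (\<exists>U. U \<epsilon> F \<and> x \<epsilon> U)"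
proof (rule mem_Coll)
  obtain u where "\<forall>x. x \<epsilon> u \<longleftrightarrow> (\<exists>b. x \<epsilon> b \<and> b \<epsilon> F)"
    using ZF unfolding ZF_model_def union_ax_def by blast
  then show "is_set (\<lambda>x. \<exists>U. U \<epsilon> F \<and> x \<epsilon> U)"
    unfolding is_set_def by (intro exI[of _ u]) (simp add: conj_commute)
qed

lemma open_sub: "topological_space E X T \<Longrightarrow> U \<epsilon> T \<Longrightarrow> U \<sqsubseteq> X"
  unfolding topological_space_def by blast

lemma compl_compl:
  assumes "A \<sqsubseteq> X" shows "compl X (compl X A) = A"
proof (rule set_eqI)
  fix x
  have "x \<epsilon> compl X (compl X A) \<longleftrightarrow> x \<epsilon> X \<and> \<not> x \<epsilon> compl X A" by (rule mem_compl)
  also have "\<dots> \<longleftrightarrow> x \<epsilon> A" unfolding mem_compl using subD[OF assms] by blast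
  finally show "x \<epsilon> compl X (compl X A) \<longleftrightarrow> x \<epsilon> A" .
qed

lemma compl_sub: "compl X A \<sqsubseteq> X"
  unfolding sub_iff by simp

lemma closed_compl_iff: "A \<sqsubseteq> X \<Longrightarrow> closed_set E X T (compl X A) \<longleftrightarrow> A \<epsilon> T"
  unfolding closed_set_def by (simp only: compl_compl compl_sub simp_thms)

text \<open>Convergence of a function of HOL whose values at natural numbers matter. It separates the limit
  statement from the requirement that the sequence is an element of the model, so that limits of
  compound expressions can be computed before the corresponding sequence is constructed.\<close>

definition tends :: "'v \<Rightarrow> 'v \<Rightarrow> ('v \<Rightarrow> 'v) \<Rightarrow> 'v \<Rightarrow> bool" where
  "tends X T f x \<longleftrightarrow> x \<epsilon> X \<and>
     (\<forall>U. U \<epsilon> T \<and> x \<epsilon> U \<longrightarrow>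
        (\<exists>m. m \<epsilon> omega E \<and> (\<forall>n. n \<epsilon> omega E \<and> m \<preceq> n \<longrightarrow> f n \<epsilon> U)))"

lemma converges_iff: "converges E X T s x \<longleftrightarrow> is_fun E s (omega E) X \<and> tends X T (app E s) x"
  unfolding converges_def tends_def by simp

lemma tendsD:
  assumes "tends X T f x" "U \<epsilon> T" "x \<epsilon> U"
  obtains m where "m \<epsilon> omega E" "\<And>n. n \<epsilon> omega E \<Longrightarrow> m \<preceq> n \<Longrightarrow> f n \<epsilon> U"
  using assms unfolding tends_def by blast

lemma tends_cong:
  assumes "tends X T f x" "\<And>n. n \<epsilon> omega E \<Longrightarrow> f n = g n" shows "tends X T g x"
  using assms unfolding tends_def by simp

lemma tends_const: "x \<epsilon> X \<Longrightarrow> tends X T (\<lambda>n. x) x"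
  unfolding tends_def using zero_omega by blast

text \<open>Dominating the identity is a weaker demand on \<open>k\<close> than being increasing. It admits functions that
  repeat values, such as the one that sends \<open>n\<close> to the next element of an infinite set.\<close>

lemma tends_reindex:
  assumes "tends X T f x" "\<And>n. n \<epsilon> omega E \<Longrightarrow> k n \<epsilon> omega E \<and> n \<preceq> k n"
  shows "tends X T (\<lambda>n. f (k n)) x"
  unfolding tends_def
proof (intro conjI allI impI)
  show "x \<epsilon> X" using assms(1) unfolding tends_def by blast
  fix U assume "U \<epsilon> T \<and> x \<epsilon> U"
  then obtain m where m: "m \<epsilon> omega E" "\<And>n. n \<epsilon> omega E \<Longrightarrow> m \<preceq> n \<Longrightarrow> f n \<epsilon> U"
    using tendsD[OF assms(1)] by blast
  have "f (k n) \<epsilon> U" if "n \<epsilon> omega E" "m \<preceq> n" for n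
    using m(2)[of "k n"] assms(2)[OF that(1)] le_trans[of "k n" m n] that(2) by iprover
  then show "\<exists>m. m \<epsilon> omega E \<and> (\<forall>n. n \<epsilon> omega E \<and> m \<preceq> n \<longrightarrow> f (k n) \<epsilon> U)"
    using m(1) by blast
qed

lemma sequentially_closedD:
  assumes "sequentially_closed E X T A" "is_fun E s (omega E) A" "tends X T (app E s) x"
  shows "x \<epsilon> A"
proof -
  have "is_fun E s (omega E) X"
    using fun_codomain[OF assms(2)] app_type[OF assms(2)] assms(1) subD
    unfolding sequentially_closed_def by blast
  then show ?thesis using assms unfolding sequentially_closed_def converges_iff by blast
qed

lemma sequentially_closedI:
  assumes "A \<sqsubseteq> X"
    and "\<And>s x. is_fun E s (omega E) A \<Longrightarrow> tends X T (app E s) x \<Longrightarrow> x \<epsilon> A"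
  shows "sequentially_closed E X T A"
  using assms unfolding sequentially_closed_def converges_iff by blast

lemma closed_imp_sequentially_closed:
  assumes "closed_set E X T A" shows "sequentially_closed E X T A"
proof (rule sequentially_closedI)
  show "A \<sqsubseteq> X" using assms unfolding closed_set_def by blast
  fix s x assume s: "is_fun E s (omega E) A" and x: "tends X T (app E s) x"
  show "x \<epsilon> A"
  proof (rule ccontr)
    assume "\<not> x \<epsilon> A"
    then have "x \<epsilon> compl X A" using x unfolding tends_def by simp
    moreover have "compl X A \<epsilon> T" using assms unfolding closed_set_def by blast
    ultimately obtain m where "m \<epsilon> omega E"
      "\<And>n. n \<epsilon> omega E \<Longrightarrow> m \<preceq> n \<Longrightarrow> app E s n \<epsilon> compl X A"
      using tendsD[OF x] by blast
    then show False using app_type[OF s] by auto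
  qed
qed

lemma sequential_closed_iff:
  assumes "sequential_space E X T"
  shows "closed_set E X T A \<longleftrightarrow> sequentially_closed E X T A"
  using assms closed_imp_sequentially_closed unfolding sequential_space_def by blast

text \<open>The complement of \<open>C\<close> is a term, so the condition that it is open is first rewritten as the
  existence of an open set with the same elements.\<close>

lemma mem_cl:
  "x \<epsilon> cl E X T A \<longleftrightarrow> x \<epsilon> X \<and> (\<forall>C. closed_set E X T C \<and> A \<sqsubseteq> C \<longrightarrow> x \<epsilon> C)"
  unfolding cl_def
proof (rule mem_Coll, rule separation[where a = X])
  have compl: "compl X C \<epsilon> T \<longleftrightarrow> (\<exists>U. U \<epsilon> T \<and> (\<forall>x. x \<epsilon> U \<longleftrightarrow> x \<epsilon> X \<and> \<not> x \<epsilon> C))" for C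
  proof -
    have "(\<forall>x. x \<epsilon> U \<longleftrightarrow> x \<epsilon> X \<and> \<not> x \<epsilon> C) \<longleftrightarrow> U = compl X C" for U
      unfolding set_eq_iff[of U] by simp
    then show ?thesis by simp
  qed
  show "definable (\<lambda>\<rho>. \<rho> 0 \<epsilon> X \<and> (\<forall>C. closed_set E X T C \<and> A \<sqsubseteq> C \<longrightarrow> \<rho> 0 \<epsilon> C))"
    unfolding closed_set_def compl by (intro definable_intros)
qed simp

lemma sub_cl: "A \<sqsubseteq> X \<Longrightarrow> A \<sqsubseteq> cl E X T A"
  unfolding sub_iff mem_cl by blast

text \<open>Closed sets are sequentially closed, and sequentially closed sets are stable under
  intersections.\<close>

lemma cl_sequentially_closed: "sequentially_closed E X T (cl E X T A)"
proof (rule sequentially_closedI)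
  show "cl E X T A \<sqsubseteq> X" unfolding sub_iff mem_cl by blast
  fix s x assume s: "is_fun E s (omega E) (cl E X T A)" and x: "tends X T (app E s) x"
  have "x \<epsilon> C" if C: "closed_set E X T C" "A \<sqsubseteq> C" for C
  proof -
    have "is_fun E s (omega E) C"
      using fun_codomain[OF s] app_type[OF s] C unfolding mem_cl by blast
    then show ?thesis
      using sequentially_closedD closed_imp_sequentially_closed[OF C(1)] x by blast
  qed
  moreover have "x \<epsilon> X" using x unfolding tends_def by blast
  ultimately show "x \<epsilon> cl E X T A" unfolding mem_cl by blast
qed

section \<open>Products\<close>

lemma mem_prod_topology:
  assumes "topological_space E X T" "topological_space E Y S"
  shows "W \<epsilon> prod_topology E T S \<longleftrightarrow>
    (\<forall>p. p \<epsilon> W \<longrightarrow> (\<exists>U V. U \<epsilon> T \<and> V \<epsilon> S \<and> p \<epsilon> cprod E U V \<and> cprod E U V \<sqsubseteq> W))"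
  unfolding prod_topology_def
proof (rule mem_Coll)
  obtain P where P: "\<And>W. W \<epsilon> P \<longleftrightarrow> W \<sqsubseteq> cprod E X Y" using power_exists by meson
  have sub: "cprod E U V \<sqsubseteq> W \<longleftrightarrow> (\<forall>x y. x \<epsilon> U \<and> y \<epsilon> V \<longrightarrow> \<langle>x, y\<rangle> \<epsilon> W)" for U V W
    unfolding sub_iff mem_cprod by blast
  show "is_set (\<lambda>W. \<forall>p. p \<epsilon> W \<longrightarrow>
      (\<exists>U V. U \<epsilon> T \<and> V \<epsilon> S \<and> p \<epsilon> cprod E U V \<and> cprod E U V \<sqsubseteq> W))"
  proof (rule separation)
    show "definable (\<lambda>\<rho>. \<forall>p. p \<epsilon> \<rho> 0 \<longrightarrow>
        (\<exists>U V. U \<epsilon> T \<and> V \<epsilon> S \<and> p \<epsilon> cprod E U V \<and> cprod E U V \<sqsubseteq> \<rho> 0))"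
      unfolding sub mem_cprod by (intro definable_intros)
    fix W assume W: "\<forall>p. p \<epsilon> W \<longrightarrow>
      (\<exists>U V. U \<epsilon> T \<and> V \<epsilon> S \<and> p \<epsilon> cprod E U V \<and> cprod E U V \<sqsubseteq> W)"
    have "p \<epsilon> cprod E X Y" if p: "p \<epsilon> W" for p
    proof -
      obtain U V where UV: "U \<epsilon> T" "V \<epsilon> S" "p \<epsilon> cprod E U V" using W p by blast
      have "U \<sqsubseteq> X" "V \<sqsubseteq> Y" using UV open_sub assms by blast+
      then show ?thesis using UV(3) subD unfolding mem_cprod by blast
    qed
    then show "W \<epsilon> P" unfolding P sub_iff by blast
  qed
qed

text \<open>The working form of the product topology, with boxes replaced by conditions on coordinates.\<close>

lemma prod_open_iff:
  assumes "topological_space E X T" "topological_space E Y S"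
  shows "W \<epsilon> prod_topology E T S \<longleftrightarrow> W \<sqsubseteq> cprod E X Y \<and>
    (\<forall>x y. \<langle>x, y\<rangle> \<epsilon> W \<longrightarrow> (\<exists>U V. U \<epsilon> T \<and> V \<epsilon> S \<and> x \<epsilon> U \<and> y \<epsilon> V \<and>
       (\<forall>x' y'. x' \<epsilon> U \<and> y' \<epsilon> V \<longrightarrow> \<langle>x', y'\<rangle> \<epsilon> W)))" (is "?L \<longleftrightarrow> ?R")
proof -
  have sub: "cprod E U V \<sqsubseteq> W \<longleftrightarrow> (\<forall>x y. x \<epsilon> U \<and> y \<epsilon> V \<longrightarrow> \<langle>x, y\<rangle> \<epsilon> W)" for U V
    unfolding sub_iff mem_cprod by blast
  show ?thesis
  proof
    assume L: ?L
    have box: "\<exists>U V. U \<epsilon> T \<and> V \<epsilon> S \<and> p \<epsilon> cprod E U V \<and> cprod E U V \<sqsubseteq> W" if "p \<epsilon> W" for p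
      using L that unfolding mem_prod_topology[OF assms] by iprover
    have "p \<epsilon> cprod E X Y" if p: "p \<epsilon> W" for p
    proof -
      obtain U V where UV: "U \<epsilon> T" "V \<epsilon> S" "p \<epsilon> cprod E U V" using box[OF p] by blast
      have "U \<sqsubseteq> X" "V \<sqsubseteq> Y" using UV open_sub assms by blast+
      then show ?thesis using UV(3) subD unfolding mem_cprod by blast
    qed
    then have "W \<sqsubseteq> cprod E X Y" unfolding sub_iff by blast
    moreover have "\<exists>U V. U \<epsilon> T \<and> V \<epsilon> S \<and> x \<epsilon> U \<and> y \<epsilon> V \<and>
       (\<forall>x' y'. x' \<epsilon> U \<and> y' \<epsilon> V \<longrightarrow> \<langle>x', y'\<rangle> \<epsilon> W)" if "\<langle>x, y\<rangle> \<epsilon> W" for x y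
      using box[OF that] unfolding sub opair_mem_cprod by iprover
    ultimately show ?R by iprover
  next
    assume R: ?R
    show ?L unfolding mem_prod_topology[OF assms]
    proof (intro allI impI)
      fix p assume p: "p \<epsilon> W"
      then have "p \<epsilon> cprod E X Y" using R subD by blast
      then obtain x y where xy: "p = \<langle>x, y\<rangle>" unfolding mem_cprod by blast
      have "\<exists>U V. U \<epsilon> T \<and> V \<epsilon> S \<and> x \<epsilon> U \<and> y \<epsilon> V \<and>
          (\<forall>x' y'. x' \<epsilon> U \<and> y' \<epsilon> V \<longrightarrow> \<langle>x', y'\<rangle> \<epsilon> W)"
        using R p unfolding xy by iprover
      then show "\<exists>U V. U \<epsilon> T \<and> V \<epsilon> S \<and> p \<epsilon> cprod E U V \<and> cprod E U V \<sqsubseteq> W"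
        unfolding sub xy opair_mem_cprod by iprover
    qed
  qed
qed

lemma open_inter:
  assumes "topological_space E X T" "U \<epsilon> T" "V \<epsilon> T"
  shows "\<exists>W. W \<epsilon> T \<and> (\<forall>x. x \<epsilon> W \<longleftrightarrow> x \<epsilon> U \<and> x \<epsilon> V)"
proof -
  have "Coll E (\<lambda>x. x \<epsilon> U \<and> x \<epsilon> V) \<epsilon> T" using assms unfolding topological_space_def by blast
  then show ?thesis by (intro exI[of _ "Coll E (\<lambda>x. x \<epsilon> U \<and> x \<epsilon> V)"]) simp
qed

lemma prod_topological_space:
  assumes X: "topological_space E X T" and Y: "topological_space E Y S"
  shows "topological_space E (cprod E X Y) (prod_topology E T S)"
  unfolding topological_space_def
proof (intro conjI allI impI)
  let ?T = "prod_topology E T S"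
  have openI: "W \<epsilon> ?T" if "\<And>p. p \<epsilon> W \<Longrightarrow> p \<epsilon> cprod E X Y"
    "\<And>x y. \<langle>x, y\<rangle> \<epsilon> W \<Longrightarrow> \<exists>U V. U \<epsilon> T \<and> V \<epsilon> S \<and> x \<epsilon> U \<and> y \<epsilon> V \<and>
        (\<forall>x' y'. x' \<epsilon> U \<and> y' \<epsilon> V \<longrightarrow> \<langle>x', y'\<rangle> \<epsilon> W)" for W
    using that unfolding prod_open_iff[OF X Y] sub_iff by iprover
  have box: "\<exists>U V. U \<epsilon> T \<and> V \<epsilon> S \<and> x \<epsilon> U \<and> y \<epsilon> V \<and>
        (\<forall>x' y'. x' \<epsilon> U \<and> y' \<epsilon> V \<longrightarrow> \<langle>x', y'\<rangle> \<epsilon> W)"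
    if "W \<epsilon> ?T" "\<langle>x, y\<rangle> \<epsilon> W" for W x y
    using that unfolding prod_open_iff[OF X Y] by iprover
  show sub: "W \<sqsubseteq> cprod E X Y" if "W \<epsilon> ?T" for W
    using that unfolding prod_open_iff[OF X Y] by iprover
  show "zero \<epsilon> ?T" by (rule openI) simp_all
  have XY: "X \<epsilon> T" "Y \<epsilon> S" using X Y unfolding topological_space_def by iprover+
  show "cprod E X Y \<epsilon> ?T"
    by (rule openI, assumption) (use XY in \<open>unfold opair_mem_cprod, iprover\<close>)
  show "Coll E (\<lambda>x. x \<epsilon> W \<and> x \<epsilon> W') \<epsilon> ?T" if W: "W \<epsilon> ?T \<and> W' \<epsilon> ?T" for W W'
  proof (rule openI)
    show "p \<epsilon> cprod E X Y" if p: "p \<epsilon> Coll E (\<lambda>x. x \<epsilon> W \<and> x \<epsilon> W')" for p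
      using subD[OF sub[OF conjunct1[OF W]]] p unfolding mem_inter by iprover
    fix x y assume xy: "\<langle>x, y\<rangle> \<epsilon> Coll E (\<lambda>x. x \<epsilon> W \<and> x \<epsilon> W')"
    then have xy': "\<langle>x, y\<rangle> \<epsilon> W" "\<langle>x, y\<rangle> \<epsilon> W'" unfolding mem_inter by iprover+
    obtain U V where UV: "U \<epsilon> T" "V \<epsilon> S" "x \<epsilon> U" "y \<epsilon> V"
      "\<And>x' y'. x' \<epsilon> U \<Longrightarrow> y' \<epsilon> V \<Longrightarrow> \<langle>x', y'\<rangle> \<epsilon> W"
      using box[OF conjunct1[OF W] xy'(1)] by iprover
    obtain U' V' where UV': "U' \<epsilon> T" "V' \<epsilon> S" "x \<epsilon> U'" "y \<epsilon> V'"
      "\<And>x' y'. x' \<epsilon> U' \<Longrightarrow> y' \<epsilon> V' \<Longrightarrow> \<langle>x', y'\<rangle> \<epsilon> W'"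
      using box[OF conjunct2[OF W] xy'(2)] by iprover
    obtain U'' where U'': "U'' \<epsilon> T" "\<And>x. x \<epsilon> U'' \<longleftrightarrow> x \<epsilon> U \<and> x \<epsilon> U'"
      using open_inter[OF X UV(1) UV'(1)] by iprover
    obtain V'' where V'': "V'' \<epsilon> S" "\<And>x. x \<epsilon> V'' \<longleftrightarrow> x \<epsilon> V \<and> x \<epsilon> V'"
      using open_inter[OF Y UV(2) UV'(2)] by iprover
    have "x \<epsilon> U''" "y \<epsilon> V''" unfolding U''(2) V''(2) using UV UV' by iprover+
    moreover have "\<langle>x', y'\<rangle> \<epsilon> Coll E (\<lambda>x. x \<epsilon> W \<and> x \<epsilon> W')" if "x' \<epsilon> U''" "y' \<epsilon> V''" for x' y'
      using that UV(5) UV'(5) unfolding U''(2) V''(2) mem_inter by iprover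
    ultimately show "\<exists>U V. U \<epsilon> T \<and> V \<epsilon> S \<and> x \<epsilon> U \<and> y \<epsilon> V \<and>
        (\<forall>x' y'. x' \<epsilon> U \<and> y' \<epsilon> V \<longrightarrow> \<langle>x', y'\<rangle> \<epsilon> Coll E (\<lambda>x. x \<epsilon> W \<and> x \<epsilon> W'))"
      using U''(1) V''(1) by iprover
  qed
  show "Coll E (\<lambda>x. \<exists>W. W \<epsilon> F \<and> x \<epsilon> W) \<epsilon> ?T" if F: "F \<sqsubseteq> ?T" for F
  proof (rule openI)
    note F' = subD[OF F]
    show "p \<epsilon> cprod E X Y" if p: "p \<epsilon> Coll E (\<lambda>x. \<exists>W. W \<epsilon> F \<and> x \<epsilon> W)" for p
      using subD[OF sub[OF F']] p unfolding mem_Union by iprover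
    fix x y assume "\<langle>x, y\<rangle> \<epsilon> Coll E (\<lambda>x. \<exists>W. W \<epsilon> F \<and> x \<epsilon> W)"
    then obtain W where W: "W \<epsilon> F" "\<langle>x, y\<rangle> \<epsilon> W" unfolding mem_Union by iprover
    show "\<exists>U V. U \<epsilon> T \<and> V \<epsilon> S \<and> x \<epsilon> U \<and> y \<epsilon> V \<and>
        (\<forall>x' y'. x' \<epsilon> U \<and> y' \<epsilon> V \<longrightarrow> \<langle>x', y'\<rangle> \<epsilon> Coll E (\<lambda>x. \<exists>W. W \<epsilon> F \<and> x \<epsilon> W))"
      using box[OF F'[OF W(1)] W(2)] W(1) unfolding mem_Union by iprover
  qed
qed

lemma tends_pair:
  assumes X: "topological_space E X T" and Y: "topological_space E Y S"
    and f: "tends X T f x" and g: "tends Y S g y"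
  shows "tends (cprod E X Y) (prod_topology E T S) (\<lambda>n. \<langle>f n, g n\<rangle>) \<langle>x, y\<rangle>"
  unfolding tends_def
proof (intro conjI allI impI)
  show "\<langle>x, y\<rangle> \<epsilon> cprod E X Y" using f g unfolding tends_def by simp
  fix W assume W: "W \<epsilon> prod_topology E T S \<and> \<langle>x, y\<rangle> \<epsilon> W"
  obtain U V where UV: "U \<epsilon> T" "V \<epsilon> S" "x \<epsilon> U" "y \<epsilon> V"
    "\<And>x' y'. x' \<epsilon> U \<Longrightarrow> y' \<epsilon> V \<Longrightarrow> \<langle>x', y'\<rangle> \<epsilon> W"
    using conjunct2[OF conjunct1[OF W, unfolded prod_open_iff[OF X Y]], rule_format, OF conjunct2[OF W]]
    by (elim exE conjE) iprover
  obtain m where m: "m \<epsilon> omega E" "\<And>n. n \<epsilon> omega E \<Longrightarrow> m \<preceq> n \<Longrightarrow> f n \<epsilon> U"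
    using tendsD[OF f UV(1,3)] by blast
  obtain m' where m': "m' \<epsilon> omega E" "\<And>n. n \<epsilon> omega E \<Longrightarrow> m' \<preceq> n \<Longrightarrow> g n \<epsilon> V"
    using tendsD[OF g UV(2,4)] by blast
  obtain k where k: "k \<epsilon> omega E" "m \<preceq> k" "m' \<preceq> k" using omega_max[OF m(1) m'(1)] by (elim exE conjE)
  have "\<langle>f n, g n\<rangle> \<epsilon> W" if n: "n \<epsilon> omega E" "k \<preceq> n" for n
    using UV(5)[OF m(2)[OF n(1) le_trans[OF n(1) k(2) n(2)]]
        m'(2)[OF n(1) le_trans[OF n(1) k(3) n(2)]]] .
  then show "\<exists>m. m \<epsilon> omega E \<and> (\<forall>n. n \<epsilon> omega E \<and> m \<preceq> n \<longrightarrow> \<langle>f n, g n\<rangle> \<epsilon> W)"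
    by (intro exI[of _ k] conjI allI impI k(1)) (elim conjE)
qed

section \<open>Tubes around sequentially compact sets\<close>

lemma pair_sequence:
  assumes X: "topological_space E X T" and Y: "topological_space E Y S"
    and A: "sequentially_closed E (cprod E X Y) (prod_topology E T S) A"
    and s: "is_fun E s (omega E) X" and r: "is_fun E r (omega E) Y"
    and mem: "\<And>n. n \<epsilon> omega E \<Longrightarrow> \<langle>app E s n, app E r n\<rangle> \<epsilon> A"
    and sx: "tends X T (app E s) x" and ry: "tends Y S (app E r) y"
  shows "\<langle>x, y\<rangle> \<epsilon> A"
proof -
  obtain p where p: "is_fun E p (omega E) (cprod E X Y)"
    "\<And>n. n \<epsilon> omega E \<Longrightarrow> app E p n = \<langle>app E s n, app E r n\<rangle>"
    using pair_fun_exists[OF s r] by blast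
  have pA: "is_fun E p (omega E) A" using fun_codomain[OF p(1)] mem p(2) by simp
  have "tends (cprod E X Y) (prod_topology E T S) (app E p) \<langle>x, y\<rangle>"
    by (rule tends_cong[OF tends_pair[OF X Y sx ry]]) (simp add: p(2))
  then show ?thesis by (rule sequentially_closedD[OF A pA])
qed

text \<open>A sequence in the slice becomes a sequence in \<open>A\<close> when it is paired with the constant
  sequence \<open>y\<close>.\<close>

lemma slice_sequentially_closed:
  assumes X: "topological_space E X T" and Y: "topological_space E Y S"
    and A: "sequentially_closed E (cprod E X Y) (prod_topology E T S) A"
    and K: "sequentially_closed E X T K" and y: "y \<epsilon> Y"
    and B: "\<And>x. x \<epsilon> B \<longleftrightarrow> x \<epsilon> K \<and> \<langle>x, y\<rangle> \<epsilon> A"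
  shows "sequentially_closed E X T B"
proof (rule sequentially_closedI)
  have KX: "K \<sqsubseteq> X" using K unfolding sequentially_closed_def by blast
  then show "B \<sqsubseteq> X" unfolding sub_iff B by blast
  fix s x assume s: "is_fun E s (omega E) B" and x: "tends X T (app E s) x"
  have sK: "is_fun E s (omega E) K" using fun_codomain[OF s] app_type[OF s] unfolding B by blast
  have sX: "is_fun E s (omega E) X" using fun_codomain[OF sK] app_type[OF sK] subD[OF KX] by blast
  obtain r where r: "is_fun E r (omega E) Y" "\<And>n. n \<epsilon> omega E \<Longrightarrow> app E r n = y"
    using const_fun_exists[OF y, of "omega E"] by blast
  have "\<langle>x, y\<rangle> \<epsilon> A"
  proof (rule pair_sequence[OF X Y A sX r(1) _ x])
    show "\<langle>app E s n, app E r n\<rangle> \<epsilon> A" if "n \<epsilon> omega E" for n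
      using app_type[OF s that] unfolding B r(2)[OF that] by simp
    show "tends Y S (app E r) y"
      by (rule tends_cong[OF tends_const[OF y]]) (simp add: r(2))
  qed
  then show "x \<epsilon> B" using sequentially_closedD[OF K sK x] unfolding B by blast
qed

text \<open>The only appeal to PCAC. For each \<open>n\<close> a point \<open>x \<in> K\<close> with \<open>\<langle>x, s\<^sub>n\<rangle> \<in> A\<close> is wanted, but the
  hypothesis provides such points \<open>c\<^sub>j\<close> only for \<open>j\<close> in some infinite \<open>J\<close>. As \<open>J\<close> is
  unbounded, \<open>k\<^sub>n\<close> can be taken as the least element of \<open>J\<close> that is at least \<open>n\<close>, and
  \<open>u\<^sub>n = c\<close> at \<open>k\<^sub>n\<close>. The sequence \<open>k\<close> may repeat values; \<open>n \<preceq> k\<^sub>n\<close> is all that limits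
  require.\<close>

lemma partial_choice_sequence:
  assumes PCAC: "PCAC_scl E X T"
    and K: "sequentially_closed E X T K" and s: "is_fun E s (omega E) Y"
    and A: "\<And>y B. y \<epsilon> Y \<Longrightarrow> (\<And>x. x \<epsilon> B \<longleftrightarrow> x \<epsilon> K \<and> \<langle>x, y\<rangle> \<epsilon> A) \<Longrightarrow> sequentially_closed E X T B"
    and ne: "\<And>n. n \<epsilon> omega E \<Longrightarrow> \<exists>x. x \<epsilon> K \<and> \<langle>x, app E s n\<rangle> \<epsilon> A"
  shows "\<exists>k u. is_fun E k (omega E) (omega E) \<and> is_fun E u (omega E) K \<and>
    (\<forall>n. n \<epsilon> omega E \<longrightarrow> n \<preceq> app E k n \<and> \<langle>app E u n, app E s (app E k n)\<rangle> \<epsilon> A)"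
proof -
  obtain P where P: "\<And>B. B \<epsilon> P \<longleftrightarrow> B \<sqsubseteq> K" using power_exists by meson
  \<comment> \<open>The slice over \<open>s\<^sub>n\<close>, phrased through pairs in \<open>s\<close> to be definable.\<close>
  let ?R = "\<lambda>n B. \<forall>x. x \<epsilon> B \<longleftrightarrow> x \<epsilon> K \<and> (\<exists>y p. \<langle>n, y\<rangle> \<epsilon> s \<and> p = \<langle>x, y\<rangle> \<and> p \<epsilon> A)"
  have R_iff: "?R n B \<longleftrightarrow> (\<forall>x. x \<epsilon> B \<longleftrightarrow> x \<epsilon> K \<and> \<langle>x, app E s n\<rangle> \<epsilon> A)" if "n \<epsilon> omega E" for n B
    using that by (simp add: opair_mem_fun[OF s])
  have "\<exists>F. is_fun E F (omega E) P \<and> (\<forall>n. n \<epsilon> omega E \<longrightarrow> ?R n (app E F n))"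
  proof (rule fun_exists)
    show "definable (\<lambda>\<rho>. ?R (\<rho> (Suc 0)) (\<rho> 0))" by (intro definable_intros)
    fix n assume n: "n \<epsilon> omega E"
    have "is_set (\<lambda>x. x \<epsilon> K \<and> \<langle>x, app E s n\<rangle> \<epsilon> A)"
      by (rule separation[where a = K]) (intro definable_intros, simp)
    then obtain B where B: "\<And>x. x \<epsilon> B \<longleftrightarrow> x \<epsilon> K \<and> \<langle>x, app E s n\<rangle> \<epsilon> A"
      unfolding is_set_def by blast
    show "\<exists>!B. B \<epsilon> P \<and> ?R n B"
      unfolding R_iff[OF n]
    proof (rule ex1I[of _ B])
      show "B \<epsilon> P \<and> (\<forall>x. x \<epsilon> B \<longleftrightarrow> x \<epsilon> K \<and> \<langle>x, app E s n\<rangle> \<epsilon> A)"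
        unfolding P sub_iff B by simp
      show "B' = B" if "B' \<epsilon> P \<and> (\<forall>x. x \<epsilon> B' \<longleftrightarrow> x \<epsilon> K \<and> \<langle>x, app E s n\<rangle> \<epsilon> A)" for B'
        by (rule set_eqI) (use that B in simp)
    qed
  qed
  then obtain F where F: "is_fun E F (omega E) P"
    and F_R: "\<forall>n. n \<epsilon> omega E \<longrightarrow> ?R n (app E F n)" by (elim exE conjE)
  have F_mem: "x \<epsilon> app E F n \<longleftrightarrow> x \<epsilon> K \<and> \<langle>x, app E s n\<rangle> \<epsilon> A" if n: "n \<epsilon> omega E" for n x
    using F_R[rule_format, OF n] unfolding opair_mem_fun[OF s] using n by simp
  have "nonempty E (app E F n) \<and> sequentially_closed E X T (app E F n)" if n: "n \<epsilon> omega E" for n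
    using ne[OF n] A[OF app_type[OF s n] F_mem[OF n]] unfolding nonempty_def F_mem[OF n] by simp
  then obtain J c where J: "J \<sqsubseteq> omega E" "\<not> finite_set E J" and c: "is_fun E c J X"
    and c_F: "\<And>j. j \<epsilon> J \<Longrightarrow> app E c j \<epsilon> app E F j"
    using PCAC[unfolded PCAC_scl_def, rule_format, of "omega E" F P] omega_countable omega_infinite F
    by blast
  have J_omega: "j \<epsilon> omega E" if "j \<epsilon> J" for j using subD[OF J(1) that] .
  have unbounded: "\<exists>j. j \<epsilon> J \<and> n \<preceq> j" if n: "n \<epsilon> omega E" for n
  proof (rule ccontr)
    assume "\<not> (\<exists>j. j \<epsilon> J \<and> n \<preceq> j)"
    then have "J \<sqsubseteq> n" unfolding sub_iff using omega_linear[OF J_omega n] by blast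
    then show False using bounded_finite[OF n] J(2) by blast
  qed
  \<comment> \<open>The least element of \<open>J\<close> that is at least \<open>n\<close>.\<close>
  let ?Q = "\<lambda>n j. (j \<epsilon> J \<and> n \<preceq> j) \<and> (\<forall>i. i \<epsilon> J \<and> n \<preceq> i \<longrightarrow> j \<preceq> i)"
  have "\<exists>k. is_fun E k (omega E) J \<and> (\<forall>n. n \<epsilon> omega E \<longrightarrow> ?Q n (app E k n))"
  proof (rule fun_exists)
    show "definable (\<lambda>\<rho>. ?Q (\<rho> (Suc 0)) (\<rho> 0))" by (intro definable_intros)
    fix n assume n: "n \<epsilon> omega E"
    obtain j where j: "j \<epsilon> J \<and> n \<preceq> j" using unbounded[OF n] by (elim exE)
    have "\<exists>m. (m \<epsilon> J \<and> n \<preceq> m) \<and> (\<forall>i. i \<epsilon> J \<and> n \<preceq> i \<longrightarrow> m \<preceq> i)"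
      by (rule omega_least[where P = "\<lambda>m. m \<epsilon> J \<and> n \<preceq> m", OF _ _ j])
        (intro definable_intros, rule J_omega, erule conjunct1)
    then obtain m where m: "?Q n m" by (elim exE)
    show "\<exists>!j. j \<epsilon> J \<and> ?Q n j"
    proof (rule ex1I[of _ m])
      show "m \<epsilon> J \<and> ?Q n m" using m by simp
      fix j assume j: "j \<epsilon> J \<and> ?Q n j"
      have "m \<preceq> j" "j \<preceq> m" using m j by simp_all
      then show "j = m" using le_antisym[OF J_omega] j by blast
    qed
  qed
  then obtain k where k: "is_fun E k (omega E) J"
    and k_Q: "\<forall>n. n \<epsilon> omega E \<longrightarrow> ?Q n (app E k n)" by (elim exE conjE)
  have k_ge: "n \<preceq> app E k n" if "n \<epsilon> omega E" for n using k_Q[rule_format, OF that] by simp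
  obtain u where u: "is_fun E u (omega E) X"
    "\<And>n. n \<epsilon> omega E \<Longrightarrow> app E u n = app E c (app E k n)"
    using compose_exists[OF k c] by blast
  have u_mem: "app E u n \<epsilon> K \<and> \<langle>app E u n, app E s (app E k n)\<rangle> \<epsilon> A" if n: "n \<epsilon> omega E" for n
    using c_F[OF app_type[OF k n]] unfolding u(2)[OF n] F_mem[OF J_omega[OF app_type[OF k n]]] .
  have "is_fun E u (omega E) K" using fun_codomain[OF u(1)] u_mem by simp
  moreover have "is_fun E k (omega E) (omega E)"
    using fun_codomain[OF k] J_omega[OF app_type[OF k]] by simp
  ultimately show ?thesis using k_ge u_mem by (intro exI[of _ k] exI[of _ u]) simp
qed

text \<open>Let \<open>s\<close> be a sequence in the projection with limit \<open>y\<close>. Partial choice gives points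
  \<open>u\<^sub>n \<in> K\<close> above the terms \<open>s\<close> at \<open>k\<^sub>n\<close>, and sequential compactness gives a subsequence
  \<open>t = u \<circ> l\<close> with a limit \<open>x \<in> K\<close>. The terms \<open>s\<close> at \<open>k (l n)\<close> still converge to \<open>y\<close>, as
  \<open>n \<preceq> k (l n)\<close>; so \<open>\<langle>x, y\<rangle>\<close> is a limit of points of \<open>A\<close> and \<open>y\<close> lies in the
  projection.\<close>

lemma projection_sequentially_closed:
  assumes X: "topological_space E X T" and Y: "topological_space E Y S"
    and PCAC: "PCAC_scl E X T"
    and K: "sequentially_closed E X T K" and compact: "sequentially_compact E X T K"
    and A: "sequentially_closed E (cprod E X Y) (prod_topology E T S) A"
    and Z: "\<And>y. y \<epsilon> Z \<longleftrightarrow> y \<epsilon> Y \<and> (\<exists>x. x \<epsilon> K \<and> \<langle>x, y\<rangle> \<epsilon> A)"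
  shows "sequentially_closed E Y S Z"
proof (rule sequentially_closedI)
  show "Z \<sqsubseteq> Y" unfolding sub_iff Z by blast
  fix s y assume s: "is_fun E s (omega E) Z" and y: "tends Y S (app E s) y"
  have sY: "is_fun E s (omega E) Y" using fun_codomain[OF s] app_type[OF s] unfolding Z by blast
  have ne: "\<exists>x. x \<epsilon> K \<and> \<langle>x, app E s n\<rangle> \<epsilon> A" if "n \<epsilon> omega E" for n
    using app_type[OF s that] unfolding Z by blast
  have slice: "sequentially_closed E X T B"
    if "y \<epsilon> Y" "\<And>x. x \<epsilon> B \<longleftrightarrow> x \<epsilon> K \<and> \<langle>x, y\<rangle> \<epsilon> A" for y B
    using X Y A K that by (rule slice_sequentially_closed)
  have choice: "\<exists>k u. is_fun E k (omega E) (omega E) \<and> is_fun E u (omega E) K \<and>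
      (\<forall>n. n \<epsilon> omega E \<longrightarrow> n \<preceq> app E k n \<and> \<langle>app E u n, app E s (app E k n)\<rangle> \<epsilon> A)"
    by (rule partial_choice_sequence[OF PCAC K sY]) (erule slice, assumption, erule ne)
  obtain k u where k: "is_fun E k (omega E) (omega E)" and u: "is_fun E u (omega E) K"
    and ku: "\<And>n. n \<epsilon> omega E \<Longrightarrow> n \<preceq> app E k n \<and> \<langle>app E u n, app E s (app E k n)\<rangle> \<epsilon> A"
    using choice by blast
  obtain t x where t: "is_fun E t (omega E) K" "subsequence E t u" and x: "x \<epsilon> K" "converges E X T t x"
    using compact u unfolding sequentially_compact_def by metis
  obtain l where l: "is_fun E l (omega E) (omega E)"
    and inc: "\<And>m n. m \<epsilon> omega E \<Longrightarrow> n \<epsilon> omega E \<Longrightarrow> m \<epsilon> n \<Longrightarrow> app E l m \<epsilon> app E l n"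
    and tu: "\<And>n. n \<epsilon> omega E \<Longrightarrow> app E t n = app E u (app E l n)"
    using t(2) unfolding subsequence_def by metis
  obtain h where h: "is_fun E h (omega E) (omega E)"
    "\<And>n. n \<epsilon> omega E \<Longrightarrow> app E h n = app E k (app E l n)"
    using compose_exists[OF l k] by blast
  obtain r where r: "is_fun E r (omega E) Y"
    "\<And>n. n \<epsilon> omega E \<Longrightarrow> app E r n = app E s (app E h n)"
    using compose_exists[OF h(1) sY] by blast
  have h_ge: "app E h n \<epsilon> omega E \<and> n \<preceq> app E h n" if n: "n \<epsilon> omega E" for n
  proof -
    have ln: "app E l n \<epsilon> omega E" using app_type[OF l n] .
    have "n \<preceq> app E l n" using increasing_ge[OF l inc n] .
    then show ?thesis
      using le_trans[OF app_type[OF h(1) n], of n "app E l n"] ku[OF ln] app_type[OF h(1) n]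
      unfolding h(2)[OF n] by iprover
  qed
  have "\<langle>x, y\<rangle> \<epsilon> A"
  proof (rule pair_sequence[OF X Y A _ r(1)])
    show "is_fun E t (omega E) X" "tends X T (app E t) x" using x(2) unfolding converges_iff by blast+
    show "\<langle>app E t n, app E r n\<rangle> \<epsilon> A" if n: "n \<epsilon> omega E" for n
      using ku[OF app_type[OF l n]] unfolding tu[OF n] r(2)[OF n] h(2)[OF n] by blast
    show "tends Y S (app E r) y"
      by (rule tends_cong[OF tends_reindex[OF y h_ge]]) (simp_all add: r(2))
  qed
  then show "y \<epsilon> Z" using x(1) y unfolding Z tends_def by blast
qed

section \<open>Sequential products and quotient mappings\<close>

lemma whole_sequentially_closed: "sequentially_closed E X T X"
  by (rule sequentially_closedI) (simp_all add: sub_iff tends_def)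

text \<open>The slice of the complement of \<open>A\<close> at height \<open>y\<close> is sequentially open, hence open, so local
  sequential compactness gives \<open>U\<close> whose closure \<open>K\<close> stays in this slice. The set of all \<open>z\<close>
  with \<open>K \<times> {z}\<close> disjoint from \<open>A\<close> is the complement of a projection, hence open. It is
  described through its elements, for every \<open>V\<close> that has them, because the two applications
  obtain it in different ways: by separation, and as a preimage.\<close>

lemma tube_neighbourhood:
  assumes X: "sequential_space E X T" and Y: "sequential_space E Y S"
    and lsc: "locally_sequentially_compact E X T" and PCAC: "PCAC_scl E X T"
    and A: "sequentially_closed E (cprod E X Y) (prod_topology E T S) A"
    and x: "x \<epsilon> X" and y: "y \<epsilon> Y" and xy: "\<not> \<langle>x, y\<rangle> \<epsilon> A"
  shows "\<exists>U K. U \<epsilon> T \<and> x \<epsilon> U \<and> U \<sqsubseteq> K \<and> K \<sqsubseteq> X \<and> (\<forall>x'. x' \<epsilon> K \<longrightarrow> \<not> \<langle>x', y\<rangle> \<epsilon> A) \<and>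
    (\<forall>V. (\<forall>z. z \<epsilon> V \<longleftrightarrow> z \<epsilon> Y \<and> (\<forall>x'. x' \<epsilon> K \<longrightarrow> \<not> \<langle>x', z\<rangle> \<epsilon> A)) \<longrightarrow> V \<epsilon> S)"
proof -
  have top: "topological_space E X T" "topological_space E Y S"
    using X Y unfolding sequential_space_def by iprover+
  have "is_set (\<lambda>x. x \<epsilon> X \<and> \<langle>x, y\<rangle> \<epsilon> A)"
    by (rule separation[where a = X]) (intro definable_intros, simp)
  then obtain B where B: "\<And>x. x \<epsilon> B \<longleftrightarrow> x \<epsilon> X \<and> \<langle>x, y\<rangle> \<epsilon> A" unfolding is_set_def by blast
  have "closed_set E X T B"
    using slice_sequentially_closed[OF top A whole_sequentially_closed y B]
    unfolding sequential_closed_iff[OF X] .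
  then have "compl X B \<epsilon> T" unfolding closed_set_def by iprover
  moreover have "x \<epsilon> compl X B" unfolding mem_compl unfolding B using x xy by simp
  ultimately obtain U where U: "U \<epsilon> T" "x \<epsilon> U" "sequentially_compact E X T (cl E X T U)"
    "cl E X T U \<sqsubseteq> compl X B"
    using lsc unfolding locally_sequentially_compact_def by blast
  let ?K = "cl E X T U"
  have KX: "?K \<sqsubseteq> X" unfolding sub_iff mem_cl by blast
  have "U \<sqsubseteq> ?K" using sub_cl open_sub[OF top(1) U(1)] .
  moreover have "\<not> \<langle>x', y\<rangle> \<epsilon> A" if "x' \<epsilon> ?K" for x'
    using subD[OF U(4) that] unfolding mem_compl unfolding B by blast
  moreover have "V \<epsilon> S"
    if V: "\<forall>z. z \<epsilon> V \<longleftrightarrow> z \<epsilon> Y \<and> (\<forall>x'. x' \<epsilon> ?K \<longrightarrow> \<not> \<langle>x', z\<rangle> \<epsilon> A)" for V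
  proof -
    have VY: "V \<sqsubseteq> Y" unfolding sub_iff using V by simp
    have mem: "z \<epsilon> compl Y V \<longleftrightarrow> z \<epsilon> Y \<and> (\<exists>x'. x' \<epsilon> ?K \<and> \<langle>x', z\<rangle> \<epsilon> A)" for z
      unfolding mem_compl using V by blast
    have "sequentially_closed E Y S (compl Y V)"
      by (rule projection_sequentially_closed[OF top PCAC cl_sequentially_closed U(3) A mem])
    then have "closed_set E Y S (compl Y V)" unfolding sequential_closed_iff[OF Y] .
    then show ?thesis unfolding closed_compl_iff[OF VY] .
  qed
  ultimately show ?thesis using U(1,2) KX by (intro exI[of _ U] exI[of _ ?K]) simp
qed

lemma prod_sequential_space:
  assumes X: "sequential_space E X T" and Y: "sequential_space E Y S"
    and lsc: "locally_sequentially_compact E X T" and PCAC: "PCAC_scl E X T"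
  shows "sequential_space E (cprod E X Y) (prod_topology E T S)"
  unfolding sequential_space_def
proof (intro conjI allI impI)
  have top: "topological_space E X T" "topological_space E Y S"
    using X Y unfolding sequential_space_def by iprover+
  show "topological_space E (cprod E X Y) (prod_topology E T S)"
    by (rule prod_topological_space[OF top])
  fix A assume A: "sequentially_closed E (cprod E X Y) (prod_topology E T S) A"
  have "compl (cprod E X Y) A \<epsilon> prod_topology E T S"
    unfolding prod_open_iff[OF top]
  proof (intro conjI allI impI compl_sub)
    fix x y assume "\<langle>x, y\<rangle> \<epsilon> compl (cprod E X Y) A"
    then have xy: "x \<epsilon> X" "y \<epsilon> Y" "\<not> \<langle>x, y\<rangle> \<epsilon> A" by simp_all
    obtain U K where U: "U \<epsilon> T" "x \<epsilon> U" "U \<sqsubseteq> K" "K \<sqsubseteq> X"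
      and K: "\<forall>x'. x' \<epsilon> K \<longrightarrow> \<not> \<langle>x', y\<rangle> \<epsilon> A"
      and tube: "\<forall>V. (\<forall>z. z \<epsilon> V \<longleftrightarrow> z \<epsilon> Y \<and> (\<forall>x'. x' \<epsilon> K \<longrightarrow> \<not> \<langle>x', z\<rangle> \<epsilon> A)) \<longrightarrow> V \<epsilon> S"
      using tube_neighbourhood[OF X Y lsc PCAC A xy] by (elim exE conjE)
    have "is_set (\<lambda>z. z \<epsilon> Y \<and> (\<forall>x'. x' \<epsilon> K \<longrightarrow> \<not> \<langle>x', z\<rangle> \<epsilon> A))"
      by (rule separation[where a = Y]) (intro definable_intros, simp)
    then obtain V where V: "\<forall>z. z \<epsilon> V \<longleftrightarrow> z \<epsilon> Y \<and> (\<forall>x'. x' \<epsilon> K \<longrightarrow> \<not> \<langle>x', z\<rangle> \<epsilon> A)"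
      unfolding is_set_def by (elim exE)
    have "V \<epsilon> S" using tube V by iprover
    moreover have "y \<epsilon> V" using V K xy by simp
    moreover have "\<langle>x', y'\<rangle> \<epsilon> compl (cprod E X Y) A" if "x' \<epsilon> U" "y' \<epsilon> V" for x' y'
      using subD[OF U(3) that(1)] subD[OF U(4)] that(2) V by simp
    ultimately show "\<exists>U V. U \<epsilon> T \<and> V \<epsilon> S \<and> x \<epsilon> U \<and> y \<epsilon> V \<and>
        (\<forall>x' y'. x' \<epsilon> U \<and> y' \<epsilon> V \<longrightarrow> \<langle>x', y'\<rangle> \<epsilon> compl (cprod E X Y) A)"
      using U(1,2) by iprover
  qed
  then show "closed_set E (cprod E X Y) (prod_topology E T S) A"
    using A unfolding closed_set_def sequentially_closed_def by iprover
qed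

lemma mem_preimage:
  assumes f: "is_fun E f a b"
  shows "x \<epsilon> preimage E f a W \<longleftrightarrow> x \<epsilon> a \<and> app E f x \<epsilon> W"
  unfolding preimage_def
proof (rule mem_Coll)
  have "is_set (\<lambda>x. \<exists>y. \<langle>x, y\<rangle> \<epsilon> f \<and> y \<epsilon> W)"
    by (rule separation[where a = a]) (intro definable_intros, auto simp: opair_mem_fun[OF f])
  moreover have "(\<exists>y. \<langle>x, y\<rangle> \<epsilon> f \<and> y \<epsilon> W) \<longleftrightarrow> x \<epsilon> a \<and> app E f x \<epsilon> W" for x
    by (auto simp: opair_mem_fun[OF f])
  ultimately show "is_set (\<lambda>x. x \<epsilon> a \<and> app E f x \<epsilon> W)" by simp
qed

lemma mem_id_times:
  assumes g: "is_fun E g Z Y"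
  shows "q \<epsilon> id_times E X Z g \<longleftrightarrow>
    (\<exists>x z. x \<epsilon> X \<and> z \<epsilon> Z \<and> q = \<langle>\<langle>x, z\<rangle>, \<langle>x, app E g z\<rangle>\<rangle>)"
  unfolding id_times_def
proof (rule mem_Coll)
  have "is_set (\<lambda>q. \<exists>x z y p r. x \<epsilon> X \<and> \<langle>z, y\<rangle> \<epsilon> g \<and> p = \<langle>x, z\<rangle> \<and> r = \<langle>x, y\<rangle> \<and> q = \<langle>p, r\<rangle>)"
  proof (rule separation)
    show "definable (\<lambda>\<rho>. \<exists>x z y p r.
        x \<epsilon> X \<and> \<langle>z, y\<rangle> \<epsilon> g \<and> p = \<langle>x, z\<rangle> \<and> r = \<langle>x, y\<rangle> \<and> \<rho> 0 = \<langle>p, r\<rangle>)"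
      by (intro definable_intros)
    show "q \<epsilon> cprod E (cprod E X Z) (cprod E X Y)"
      if "\<exists>x z y p r. x \<epsilon> X \<and> \<langle>z, y\<rangle> \<epsilon> g \<and> p = \<langle>x, z\<rangle> \<and> r = \<langle>x, y\<rangle> \<and> q = \<langle>p, r\<rangle>" for q
      using that fun_opairD[OF g] by auto
  qed
  moreover have "(\<exists>x z y p r. x \<epsilon> X \<and> \<langle>z, y\<rangle> \<epsilon> g \<and> p = \<langle>x, z\<rangle> \<and> r = \<langle>x, y\<rangle> \<and> q = \<langle>p, r\<rangle>)
      \<longleftrightarrow> (\<exists>x z. x \<epsilon> X \<and> z \<epsilon> Z \<and> q = \<langle>\<langle>x, z\<rangle>, \<langle>x, app E g z\<rangle>\<rangle>)" for q
    by (simp add: opair_mem_fun[OF g])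
  ultimately show "is_set (\<lambda>q. \<exists>x z. x \<epsilon> X \<and> z \<epsilon> Z \<and> q = \<langle>\<langle>x, z\<rangle>, \<langle>x, app E g z\<rangle>\<rangle>)"
    by simp
qed

lemma id_times_fun:
  assumes g: "is_fun E g Z Y"
  shows "is_fun E (id_times E X Z g) (cprod E X Z) (cprod E X Y)"
    and "x \<epsilon> X \<Longrightarrow> z \<epsilon> Z \<Longrightarrow> app E (id_times E X Z g) \<langle>x, z\<rangle> = \<langle>x, app E g z\<rangle>"
proof -
  have opair_mem: "\<langle>\<langle>x, z\<rangle>, r\<rangle> \<epsilon> id_times E X Z g \<longleftrightarrow> x \<epsilon> X \<and> z \<epsilon> Z \<and> r = \<langle>x, app E g z\<rangle>" for x z r
    unfolding mem_id_times[OF g] by auto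
  have "q \<epsilon> cprod E (cprod E X Z) (cprod E X Y)" if "q \<epsilon> id_times E X Z g" for q
    using that app_type[OF g] unfolding mem_id_times[OF g] by auto
  moreover have "\<exists>!r. \<langle>p, r\<rangle> \<epsilon> id_times E X Z g" if "p \<epsilon> cprod E X Z" for p
    using that unfolding mem_cprod by (elim exE conjE) (simp add: opair_mem)
  ultimately show f: "is_fun E (id_times E X Z g) (cprod E X Z) (cprod E X Y)"
    unfolding is_fun_def sub_iff by iprover
  show "app E (id_times E X Z g) \<langle>x, z\<rangle> = \<langle>x, app E g z\<rangle>" if "x \<epsilon> X" "z \<epsilon> Z"
    using opair_mem[of x z "\<langle>x, app E g z\<rangle>"] that unfolding opair_mem_fun[OF f] by simp
qed

text \<open>That preimages of open sets are open is the continuity of \<open>g\<close>. Conversely, let the preimage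
  \<open>P\<close> of \<open>W\<close> be open and \<open>\<langle>x, y\<rangle> \<in> W\<close> with \<open>y = g z\<close>. The tube around \<open>\<langle>x, z\<rangle>\<close> in \<open>P\<close>
  has the open set \<open>{z'. K \<times> {z'} \<subseteq> P}\<close> as its second side. This set is the preimage under
  \<open>g\<close> of \<open>V = {y'. K \<times> {y'} \<subseteq> W}\<close>, so \<open>V\<close> is open because \<open>g\<close> is quotient, and
  \<open>U \<times> V \<subseteq> W\<close>.\<close>

lemma id_times_quotient:
  assumes X: "sequential_space E X T" and Z: "sequential_space E Z R"
    and Y: "topological_space E Y S"
    and lsc: "locally_sequentially_compact E X T" and PCAC: "PCAC_scl E X T"
    and g: "quotient_mapping E Z R Y S g"
  shows "quotient_mapping E (cprod E X Z) (prod_topology E T R) (cprod E X Y) (prod_topology E T S)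
    (id_times E X Z g)"
proof -
  have top: "topological_space E X T" "topological_space E Z R"
    using X Z unfolding sequential_space_def by iprover+
  have g_fun: "is_fun E g Z Y" and g_surj: "\<And>y. y \<epsilon> Y \<Longrightarrow> \<exists>z. z \<epsilon> Z \<and> app E g z = y"
    and g_open: "\<And>V. V \<sqsubseteq> Y \<Longrightarrow> preimage E g Z V \<epsilon> R \<longleftrightarrow> V \<epsilon> S"
    using g unfolding quotient_mapping_def surjection_def by iprover+
  let ?f = "id_times E X Z g"
  note f = id_times_fun[OF g_fun, where X = X]
  have "surjection E ?f (cprod E X Z) (cprod E X Y)"
    unfolding surjection_def
  proof (intro conjI allI impI f(1))
    fix q assume "q \<epsilon> cprod E X Y"
    then obtain x y where q: "x \<epsilon> X" "y \<epsilon> Y" "q = \<langle>x, y\<rangle>" unfolding mem_cprod by blast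
    obtain z where z: "z \<epsilon> Z" "app E g z = y" using g_surj[OF q(2)] by (elim exE conjE)
    show "\<exists>p. p \<epsilon> cprod E X Z \<and> app E ?f p = q"
      by (rule exI[of _ "\<langle>x, z\<rangle>"]) (simp add: f q z)
  qed
  moreover have "preimage E ?f (cprod E X Z) W \<epsilon> prod_topology E T R \<longleftrightarrow> W \<epsilon> prod_topology E T S"
    if W: "W \<sqsubseteq> cprod E X Y" for W
  proof -
    let ?P = "preimage E ?f (cprod E X Z) W"
    have mem_P: "\<langle>x, z\<rangle> \<epsilon> ?P \<longleftrightarrow> x \<epsilon> X \<and> z \<epsilon> Z \<and> \<langle>x, app E g z\<rangle> \<epsilon> W" for x z
      unfolding mem_preimage[OF f(1)] by (auto simp: f(2))
    have P_sub: "?P \<sqsubseteq> cprod E X Z" unfolding sub_iff mem_preimage[OF f(1)] by simp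
    show ?thesis
    proof
      assume W_open: "W \<epsilon> prod_topology E T S"
      show "?P \<epsilon> prod_topology E T R"
        unfolding prod_open_iff[OF top]
      proof (intro conjI allI impI P_sub)
        fix x z assume xz: "\<langle>x, z\<rangle> \<epsilon> ?P"
        have "\<exists>U V. U \<epsilon> T \<and> V \<epsilon> S \<and> x \<epsilon> U \<and> app E g z \<epsilon> V \<and>
            (\<forall>x' y'. x' \<epsilon> U \<and> y' \<epsilon> V \<longrightarrow> \<langle>x', y'\<rangle> \<epsilon> W)"
          using W_open xz unfolding prod_open_iff[OF top(1) Y] mem_P by iprover
        then obtain U V where UV: "U \<epsilon> T" "V \<epsilon> S" "x \<epsilon> U" "app E g z \<epsilon> V"
          "\<forall>x' y'. x' \<epsilon> U \<and> y' \<epsilon> V \<longrightarrow> \<langle>x', y'\<rangle> \<epsilon> W" by (elim exE conjE)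
        have "preimage E g Z V \<epsilon> R" using g_open open_sub[OF Y UV(2)] UV(2) by simp
        moreover have "z \<epsilon> preimage E g Z V" using xz UV(4) by (simp add: mem_preimage[OF g_fun] mem_P)
        moreover have "\<langle>x', z'\<rangle> \<epsilon> ?P" if "x' \<epsilon> U" "z' \<epsilon> preimage E g Z V" for x' z'
          using that UV(5) subD[OF open_sub[OF top(1) UV(1)]]
          by (simp add: mem_preimage[OF g_fun] mem_P)
        ultimately show "\<exists>U V. U \<epsilon> T \<and> V \<epsilon> R \<and> x \<epsilon> U \<and> z \<epsilon> V \<and>
            (\<forall>x' z'. x' \<epsilon> U \<and> z' \<epsilon> V \<longrightarrow> \<langle>x', z'\<rangle> \<epsilon> ?P)"
          using UV(1,3) by iprover
      qed
    next
      assume P_open: "?P \<epsilon> prod_topology E T R"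
      let ?A = "compl (cprod E X Z) ?P"
      have A: "sequentially_closed E (cprod E X Z) (prod_topology E T R) ?A"
        by (rule closed_imp_sequentially_closed) (use P_open closed_compl_iff[OF P_sub] in simp)
      have mem_A: "\<not> \<langle>x, z\<rangle> \<epsilon> ?A \<longleftrightarrow> \<langle>x, app E g z\<rangle> \<epsilon> W" if "x \<epsilon> X" "z \<epsilon> Z" for x z
        unfolding mem_compl mem_P using that by simp
      show "W \<epsilon> prod_topology E T S"
        unfolding prod_open_iff[OF top(1) Y]
      proof (intro conjI allI impI W)
        fix x y assume xy: "\<langle>x, y\<rangle> \<epsilon> W"
        have x: "x \<epsilon> X" and y: "y \<epsilon> Y" using subD[OF W xy] by simp_all
        obtain z where z: "z \<epsilon> Z" "app E g z = y" using g_surj[OF y] by (elim exE conjE)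
        have xz: "\<not> \<langle>x, z\<rangle> \<epsilon> ?A" using mem_A[OF x z(1)] z(2) xy by simp
        obtain U K where U: "U \<epsilon> T" "x \<epsilon> U" "U \<sqsubseteq> K" "K \<sqsubseteq> X"
          and K: "\<forall>x'. x' \<epsilon> K \<longrightarrow> \<not> \<langle>x', z\<rangle> \<epsilon> ?A"
          and tube: "\<forall>V. (\<forall>z. z \<epsilon> V \<longleftrightarrow> z \<epsilon> Z \<and> (\<forall>x'. x' \<epsilon> K \<longrightarrow> \<not> \<langle>x', z\<rangle> \<epsilon> ?A)) \<longrightarrow> V \<epsilon> R"
          using tube_neighbourhood[OF X Z lsc PCAC A x z(1) xz] by (elim exE conjE)
        have KX: "x' \<epsilon> X" if "x' \<epsilon> K" for x' using subD[OF U(4) that] .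
        have "is_set (\<lambda>y. y \<epsilon> Y \<and> (\<forall>x'. x' \<epsilon> K \<longrightarrow> \<langle>x', y\<rangle> \<epsilon> W))"
          by (rule separation[where a = Y]) (intro definable_intros, simp)
        then obtain V where V: "\<forall>y. y \<epsilon> V \<longleftrightarrow> y \<epsilon> Y \<and> (\<forall>x'. x' \<epsilon> K \<longrightarrow> \<langle>x', y\<rangle> \<epsilon> W)"
          unfolding is_set_def by (elim exE)
        have "z' \<epsilon> preimage E g Z V \<longleftrightarrow> z' \<epsilon> Z \<and> (\<forall>x'. x' \<epsilon> K \<longrightarrow> \<not> \<langle>x', z'\<rangle> \<epsilon> ?A)" for z'
          using V mem_A[OF KX, of _ z'] app_type[OF g_fun, of z'] unfolding mem_preimage[OF g_fun]
          by blast
        then have "preimage E g Z V \<epsilon> R" using tube by iprover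
        moreover have "V \<sqsubseteq> Y" unfolding sub_iff using V by simp
        ultimately have "V \<epsilon> S" using g_open by simp
        moreover have "y \<epsilon> V" using V K y mem_A[OF KX z(1)] z(2) by simp
        moreover have "\<langle>x', y'\<rangle> \<epsilon> W" if "x' \<epsilon> U" "y' \<epsilon> V" for x' y'
          using subD[OF U(3) that(1)] that(2) V by simp
        ultimately show "\<exists>U V. U \<epsilon> T \<and> V \<epsilon> S \<and> x \<epsilon> U \<and> y \<epsilon> V \<and>
            (\<forall>x' y'. x' \<epsilon> U \<and> y' \<epsilon> V \<longrightarrow> \<langle>x', y'\<rangle> \<epsilon> W)"
          using U(1,2) by iprover
      qed
    qed
  qed
  ultimately show ?thesis unfolding quotient_mapping_def by iprover
qed

end

theorem theorem3p9:
  fixes E :: "'v \<Rightarrow> 'v \<Rightarrow> bool"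
    and X1 T1 X2 T2 Y S g :: 'v
  assumes "ZF_model E"
    and "sequential_space E X1 T1"
    and "sequential_space E X2 T2"
    and "sequential_space E Y S"
    and "locally_sequentially_compact E X1 T1"
    and "PCAC_scl E X1 T1"
    and "quotient_mapping E X2 T2 Y S g"
  shows "sequential_space E (cprod E X1 X2) (prod_topology E T1 T2) \<and>
         quotient_mapping E (cprod E X1 X2) (prod_topology E T1 T2)
           (cprod E X1 Y) (prod_topology E T1 S) (id_times E X1 X2 g)"
proof -
  interpret zf_universe E by unfold_locales (rule assms(1))
  have "topological_space E Y S" using assms(4) unfolding sequential_space_def by blast
  then show ?thesis
    using prod_sequential_space[OF assms(2,3,5,6)] id_times_quotient[OF assms(2,3) _ assms(5-7)]
    by blast
qed

end
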